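(* There is a constant $C>0$ such that for all $n,d\in\mathbb{N}$ and every proximity parameter $\epsilon\in(0,\tfrac12)$ there exists a $1$-sided error unateness tester for functions $f:[n]^d\to\mathbb{R}$ that makes at most $C\cdot\frac{d\log(\max(d,n))}{\epsilon}$ queries.
   Context: $[n]=\{1,\dots,n\}$. Two points $x,y\in[n]^d$ are neighbours if $\sum_i|x_i-y_i|=1$; $e_i$ denotes the $i$-th standard basis vector. A function $f:[n]^d\to\mathbb{R}$ is unate if each dimension $i\in[d]$ can be assigned a direction up or down such that: if up, $f(x)\le f(x+e_i)$ for all $x$ with $x,x+e_i\in[n]^d$; if down, $f(x)\ge f(x+e_i)$ for all such $x$. It is monotone if all directions can be taken up. The distance between $f,g:[n]^d\to\mathbb{R}$ is the fraction of points $x$ with $f(x)\neq g(x)$; $f$ is $\epsilon$-far from a property if its distance to every function with the property is at least $\epsilon$, and $\epsilon$-close otherwise. A unateness tester is a randomized algorithm that, given $\epsilon$ and oracle (query) access to $f$, accepts with probability at least $2/3$ if $f$ is unate and rejects with probability at least $2/3$ if $f$ is $\epsilon$-far from unate. It has $1$-sided error if it accepts every unate $f$ with probability $1$. Its query complexity is the maximum number of oracle queries it makes. *)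

theory Defs
  imports "HOL-Probability.Probability"
begin

text \<open>Points of the hypergrid [n]^d are lists of length d with entries in {1..n};
  index i of the list corresponds to dimension i+1.\<close>
definition hypergrid :: "nat \<Rightarrow> nat \<Rightarrow> nat list set" where
  "hypergrid n d = {x. length x = d \<and> set x \<subseteq> {1..n}}"

definition step :: "nat list \<Rightarrow> nat \<Rightarrow> nat list" where
  "step x i = x[i := x ! i + 1]"

definition unate :: "nat \<Rightarrow> nat \<Rightarrow> (nat list \<Rightarrow> real) \<Rightarrow> bool" where
  "unate n d f \<longleftrightarrow> (\<exists>up :: nat \<Rightarrow> bool. \<forall>i<d. \<forall>x.
      x \<in> hypergrid n d \<longrightarrow> step x i \<in> hypergrid n d \<longrightarrow>
      (if up i then f x \<le> f (step x i) else f x \<ge> f (step x i)))"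

definition grid_dist :: "nat \<Rightarrow> nat \<Rightarrow> (nat list \<Rightarrow> real) \<Rightarrow> (nat list \<Rightarrow> real) \<Rightarrow> real" where
  "grid_dist n d f g = real (card {x \<in> hypergrid n d. f x \<noteq> g x}) / real (card (hypergrid n d))"

definition far_from_unate :: "nat \<Rightarrow> nat \<Rightarrow> real \<Rightarrow> (nat list \<Rightarrow> real) \<Rightarrow> bool" where
  "far_from_unate n d \<epsilon> f \<longleftrightarrow> (\<forall>g. unate n d g \<longrightarrow> grid_dist n d f g \<ge> \<epsilon>)"

text \<open>Deterministic adaptive query algorithms (decision trees): either output
  accept (True) / reject (False), or query a point and continue depending on the answer.\<close>
datatype qtree = Output bool | Query "nat list" "real \<Rightarrow> qtree"

primrec run :: "qtree \<Rightarrow> (nat list \<Rightarrow> real) \<Rightarrow> bool" where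
  "run (Output b) f = b"
| "run (Query x k) f = run (k (f x)) f"

inductive within_budget :: "nat list set \<Rightarrow> nat \<Rightarrow> qtree \<Rightarrow> bool" where
  "within_budget D q (Output b)"
| "x \<in> D \<Longrightarrow> (\<And>v. within_budget D q (k v)) \<Longrightarrow> within_budget D (Suc q) (Query x k)"

text \<open>A randomized algorithm is a probability distribution over deterministic query trees.\<close>
definition accept_prob :: "qtree pmf \<Rightarrow> (nat list \<Rightarrow> real) \<Rightarrow> real" where
  "accept_prob T f = measure_pmf.prob T {t. run t f}"

definition one_sided_unateness_tester ::
  "nat \<Rightarrow> nat \<Rightarrow> real \<Rightarrow> nat \<Rightarrow> qtree pmf \<Rightarrow> bool" where
  "one_sided_unateness_tester n d \<epsilon> q T \<longleftrightarrow>
     (\<forall>t \<in> set_pmf T. within_budget (hypergrid n d) q t) \<and>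
     (\<forall>f. unate n d f \<longrightarrow> accept_prob T f = 1) \<and>
     (\<forall>f. far_from_unate n d \<epsilon> f \<longrightarrow> 1 - accept_prob T f \<ge> 2/3)"

end

theory Submission
  imports Defs
begin

text \<open>
  Violated pairs \<open>x \<le> y\<close>, \<open>f x > f y\<close> are edges of a bipartite graph with a left and a right copy of the
  grid. Among all matchings \<open>M\<close> into pairs \<open>x \<le> y\<close> take one maximising the weight
  \<open>\<Sum> f x - f y\<close> and, secondarily, the total 2-adic valuation of the coordinate differences. The
  endpoints of its nondegenerate pairs cover all violated pairs. If \<open>2 ^ a\<close> exactly divides
  \<open>y r - x r\<close> for a pair of \<open>M\<close>, follow the path alternating between \<open>M\<close> and shifts by \<open>2 ^ a\<close> in
  dimension \<open>r\<close>, starting at \<open>x\<close>. Switching \<open>M\<close> along it shows that the path never leaves the two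
  residue classes modulo \<open>2 * 2 ^ a\<close> it starts with and that some shift on it is violated; the
  paths of different pairs are disjoint. Hence the distance to monotonicity is at most
  four times the sum over dimensions \<open>r\<close> and scales \<open>a\<close> of the fraction of violated shifts. For
  unateness, reflect each dimension into the direction with fewer violations.

  A trial of the tester picks a random dimension and a random shifted pair in it; if the two values
  differ, it resamples in the same dimension until they differ again, and rejects if the directions
  disagree. When a pair in dimension \<open>r\<close> is nonconstant with probability \<open>p\<close>, the second phase is
  entered with probability \<open>p\<close> and costs \<open>2 / p\<close> queries on average, so the expected cost is constant,
  and Markov's inequality permits truncating a sequence of trials.
\<close>

subsection \<open>Matchings and violated shifts on a grid\<close>

text \<open>Integer coordinates let shifts and reflections leave the grid without truncation, and
  the value 0 from \<open>d\<close> on turns the pointwise order of functions into the product order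
  of the grid.\<close>

definition igrid :: "nat \<Rightarrow> nat \<Rightarrow> (nat \<Rightarrow> int) set" where
  "igrid n d = {x. (\<forall>i<d. 1 \<le> x i \<and> x i \<le> int n) \<and> (\<forall>i\<ge>d. x i = 0)}"

definition translate :: "nat \<Rightarrow> int \<Rightarrow> (nat \<Rightarrow> int) \<Rightarrow> (nat \<Rightarrow> int)" where
  "translate r \<delta> x = x(r := x r + \<delta>)"

lemma finite_igrid: "finite (igrid n d)"
proof (rule finite_subset)
  show "igrid n d \<subseteq> {x. x \<in> {..<d} \<rightarrow> {1..int n} \<and> (\<forall>i. i \<notin> {..<d} \<longrightarrow> x i = 0)}"
    by (auto simp: igrid_def)
  show "finite {x. x \<in> {..<d} \<rightarrow> {1..int n} \<and> (\<forall>i. i \<notin> {..<d} \<longrightarrow> x i = 0)}"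
    using finite_set_of_finite_funs[of "{..<d}" "{1..int n}" 0]
    by (rule rev_finite_subset) auto
qed

lemma translate_translate [simp]: "translate r a (translate r b x) = translate r (b + a) x"
  by (simp add: translate_def add.assoc)

lemma translate_0 [simp]: "translate r 0 x = x"
  by (simp add: translate_def)

lemma translate_inject [simp]: "translate r a x = translate r a y \<longleftrightarrow> x = y"
  by (metis add.right_inverse translate_0 translate_translate)

lemma translate_apply: "translate r a x i = (if i = r then x i + a else x i)"
  by (simp add: translate_def)

text \<open>The left and right copies of the grid are separate, so a point may be the first
  component of one pair and the second of another. Degenerate pairs \<open>(x, x)\<close> are
  allowed; they have weight 0 and can be links of alternating paths.\<close>

definition matching :: "'a::order set \<Rightarrow> ('a \<times> 'a) set \<Rightarrow> bool" where
  "matching B M \<longleftrightarrow> M \<subseteq> B \<times> B \<and> (\<forall>(x, y)\<in>M. x \<le> y) \<and> inj_on fst M \<and> inj_on snd M"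

definition weight :: "('a \<Rightarrow> real) \<Rightarrow> ('a \<times> 'a) set \<Rightarrow> real" where
  "weight f M = (\<Sum>p\<in>M. f (fst p) - f (snd p))"

text \<open>The 2-adic valuation of \<open>m\<close> capped at \<open>K\<close>; the cap makes the
  value at 0 finite, namely \<open>K\<close>.\<close>

definition val :: "nat \<Rightarrow> int \<Rightarrow> nat" where
  "val K m = card {k\<in>{1..K}. 2 ^ k dvd m}"

definition pot :: "nat \<Rightarrow> nat \<Rightarrow> (nat \<Rightarrow> int) \<times> (nat \<Rightarrow> int) \<Rightarrow> nat" where
  "pot K d p = (\<Sum>i<d. val K (snd p i - fst p i))"

text \<open>Only the two sets of endpoints matter, so exchanging partners leaves the weight
  unchanged. Competing matchings on the same endpoints can therefore be compared by potential
  alone.\<close>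

lemma weight_eq:
  assumes "matching B M"
  shows "weight f M = sum f (fst ` M) - sum f (snd ` M)"
  using assms by (simp add: matching_def weight_def sum_subtractf sum.reindex)

lemma matching_insert:
  assumes "matching B N" "x \<in> B" "y \<in> B" "x \<le> y" "x \<notin> fst ` N" "y \<notin> snd ` N"
  shows "matching B (insert (x, y) N)"
  using assms by (auto simp: matching_def inj_on_def image_iff; metis)

lemma matching_subset:
  assumes "matching B N" "N' \<subseteq> N"
  shows "matching B N'"
  using assms by (auto simp: matching_def intro: inj_on_subset)

lemma matching_remove:
  assumes "matching B N" "(x, y) \<in> N"
  shows "matching B (N - {(x, y)})" "fst ` (N - {(x, y)}) = fst ` N - {x}" "snd ` (N - {(x, y)}) = snd ` N - {y}"
proof -
  show "matching B (N - {(x, y)})" using assms matching_subset by blast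
  show "fst ` (N - {(x, y)}) = fst ` N - {x}" "snd ` (N - {(x, y)}) = snd ` N - {y}"
    using assms by (auto simp: matching_def inj_on_def image_iff; force)+
qed

lemma sum_insert_pair:
  assumes "finite N" "x \<notin> fst ` N \<or> y \<notin> snd ` N"
  shows "sum g (insert (x, y) N) = g (x, y) + sum g N"
proof -
  have "(x, y) \<notin> N" using assms(2) by force
  then show ?thesis using assms(1) by simp
qed

section \<open>2-adic valuations under shifts by a power of two\<close>

lemma val_mono:
  assumes "\<And>k. k \<in> {1..K} \<Longrightarrow> 2 ^ k dvd m \<Longrightarrow> 2 ^ k dvd m'"
  shows "val K m \<le> val K m'"
  unfolding val_def by (rule card_mono) (use assms in auto)

lemma pow2_dvd_le:
  assumes "2 ^ k dvd (m::int)" "\<not> 2 * 2 ^ a dvd m"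
  shows "k \<le> a"
proof (rule ccontr)
  assume "\<not> k \<le> a"
  then have "(2::int) ^ Suc a dvd 2 ^ k" by (intro le_imp_power_dvd) simp
  then show False using assms by (metis dvd_trans power_Suc)
qed

text \<open>Powers of two dividing \<open>m\<close> have exponent at most \<open>a\<close> and hence
  divide \<open>2 ^ a\<close> as well, so none is lost.\<close>

lemma val_add:
  assumes "\<not> 2 * 2 ^ a dvd m"
  shows "val K m \<le> val K (m + 2 ^ a)"
proof (rule val_mono)
  fix k assume "2 ^ k dvd m"
  with assms have "k \<le> a" by (rule pow2_dvd_le[rotated])
  then have "(2::int) ^ k dvd 2 ^ a" by (rule le_imp_power_dvd)
  then show "2 ^ k dvd m + 2 ^ a" using \<open>2 ^ k dvd m\<close> by simp
qed

text \<open>Here \<open>m\<close> is an odd multiple of \<open>2 ^ a\<close>: every power dividing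
  it survives the subtraction, and \<open>2 ^ Suc a\<close> is gained. The bound
  \<open>a < K\<close> keeps this gain within the cap.\<close>

lemma val_diff:
  assumes "2 * 2 ^ a dvd m - 2 ^ a" "a < K"
  shows "val K m < val K (m - 2 ^ a)"
proof -
  have nd: "\<not> 2 * 2 ^ a dvd m"
  proof
    assume "2 * 2 ^ a dvd m"
    with assms(1) have "2 * 2 ^ a dvd m - (m - 2 ^ a)" by (rule dvd_diff[rotated])
    then have "(2::int) ^ Suc a dvd 2 ^ a" by simp
    then show False using zdvd_imp_le[of "2 ^ Suc a" "2 ^ a :: int"] by simp
  qed
  have "{k\<in>{1..K}. 2 ^ k dvd m} \<subset> {k\<in>{1..K}. 2 ^ k dvd m - 2 ^ a}"
  proof
    show "{k\<in>{1..K}. 2 ^ k dvd m} \<subseteq> {k\<in>{1..K}. 2 ^ k dvd m - 2 ^ a}"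
      using nd pow2_dvd_le by (auto intro!: dvd_diff le_imp_power_dvd)
    have "Suc a \<in> {k\<in>{1..K}. 2 ^ k dvd m - 2 ^ a}" "Suc a \<notin> {k\<in>{1..K}. 2 ^ k dvd m}"
      using assms nd by auto
    then show "{k\<in>{1..K}. 2 ^ k dvd m} \<noteq> {k\<in>{1..K}. 2 ^ k dvd m - 2 ^ a}" by blast
  qed
  then show ?thesis unfolding val_def by (rule psubset_card_mono[rotated]) simp
qed

lemma pot_cong:
  assumes "\<And>i. i < d \<Longrightarrow> snd p i - fst p i = snd q i - fst q i"
  shows "pot K d p = pot K d q"
  unfolding pot_def using assms by auto

lemma pot_shift_le:
  assumes "\<not> 2 * 2 ^ a dvd (y r - x r :: int)"
  shows "pot K d (x, y) \<le> pot K d (x, translate r (2 ^ a) y)"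
  unfolding pot_def
proof (rule sum_mono)
  fix i
  show "val K (snd (x, y) i - fst (x, y) i) \<le> val K (snd (x, translate r (2 ^ a) y) i - fst (x, translate r (2 ^ a) y) i)"
    using val_add[OF assms] by (auto simp: translate_apply algebra_simps)
qed

lemma pot_shift_less:
  assumes "2 * 2 ^ a dvd y r - x r - 2 ^ a" "a < K" "r < d"
  shows "pot K d (x, y) < pot K d (translate r (2 ^ a) x, y)"
  unfolding pot_def
proof (rule sum_strict_mono_ex1)
  have *: "val K (y r - x r) < val K (y r - (x r + 2 ^ a))"
    using val_diff[OF assms(1,2)] by (simp add: algebra_simps)
  show "\<forall>i\<in>{..<d}. val K (snd (x, y) i - fst (x, y) i) \<le> val K (snd (translate r (2 ^ a) x, y) i - fst (translate r (2 ^ a) x, y) i)"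
    using * by (auto simp: translate_apply)
  show "\<exists>i\<in>{..<d}. val K (snd (x, y) i - fst (x, y) i) < val K (snd (translate r (2 ^ a) x, y) i - fst (translate r (2 ^ a) x, y) i)"
    using * assms(3) by (auto simp: translate_apply)
qed simp

section \<open>Matchings maximal in weight, then in potential\<close>

lemma ex_optimal_matching:
  assumes "finite B"
  obtains M where "matching B M"
    "\<And>M'. matching B M' \<Longrightarrow> weight f M' \<le> weight f M"
    "\<And>M'. matching B M' \<Longrightarrow> weight f M' = weight f M \<Longrightarrow> sum \<phi> M' \<le> (sum \<phi> M :: nat)"
proof -
  let ?S = "{M. matching B M}"
  have fin: "finite ?S"
    by (rule finite_subset[of _ "Pow (B \<times> B)"]) (use assms in \<open>auto simp: matching_def\<close>)
  have "{} \<in> ?S" by (simp add: matching_def)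
  then have ne: "weight f ` ?S \<noteq> {}" by blast
  let ?W = "Max (weight f ` ?S)"
  let ?T = "{M. matching B M \<and> weight f M = ?W}"
  have W: "\<And>M. matching B M \<Longrightarrow> weight f M \<le> ?W" using fin by simp
  have "?W \<in> weight f ` ?S" using fin ne by (intro Max_in) auto
  then have "sum \<phi> ` ?T \<noteq> {}" by auto
  moreover have "finite ?T" by (rule finite_subset[OF _ fin]) auto
  ultimately have "Max (sum \<phi> ` ?T) \<in> sum \<phi> ` ?T" by (intro Max_in) auto
  then obtain M where "M \<in> ?T" "sum \<phi> M = Max (sum \<phi> ` ?T)" by auto
  then show ?thesis
    using that[of M] W \<open>finite ?T\<close> by auto
qed

locale optimal_matching =
  fixes n d K :: nat and f :: "(nat \<Rightarrow> int) \<Rightarrow> real" and M :: "((nat \<Rightarrow> int) \<times> (nat \<Rightarrow> int)) set"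
  assumes matching_M: "matching (igrid n d) M"
    and weight_max: "\<And>N. matching (igrid n d) N \<Longrightarrow> weight f N \<le> weight f M"
    and pot_max: "\<And>N. matching (igrid n d) N \<Longrightarrow> weight f N = weight f M \<Longrightarrow> sum (pot K d) N \<le> sum (pot K d) M"
begin

abbreviation "B \<equiv> igrid n d"
abbreviation "Pot \<equiv> sum (pot K d)"

lemma fin_matching: "matching B N \<Longrightarrow> finite N"
  unfolding matching_def using finite_igrid by (meson finite_SigmaI finite_subset)

lemma no_improvement:
  assumes "matching B N" "weight f M \<le> weight f N" "Pot M < Pot N"
  shows False
  using assms weight_max[of N] pot_max[of N] by force

lemma M_le: "(x, y) \<in> M \<Longrightarrow> x \<le> y"
  and M_box: "(x, y) \<in> M \<Longrightarrow> x \<in> B" "(x, y) \<in> M \<Longrightarrow> y \<in> B"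
  and M_left: "(x, y) \<in> M \<Longrightarrow> (x, y') \<in> M \<Longrightarrow> y = y'"
  and M_right: "(x, y) \<in> M \<Longrightarrow> (x', y) \<in> M \<Longrightarrow> x = x'"
proof -
  have *: "M \<subseteq> B \<times> B" "\<forall>(x, y)\<in>M. x \<le> y" "inj_on fst M" "inj_on snd M"
    using matching_M by (auto simp: matching_def)
  show "(x, y) \<in> M \<Longrightarrow> x \<le> y" "(x, y) \<in> M \<Longrightarrow> x \<in> B" "(x, y) \<in> M \<Longrightarrow> y \<in> B"
    using *(1,2) by auto
  show "(x, y) \<in> M \<Longrightarrow> (x, y') \<in> M \<Longrightarrow> y = y'" using inj_onD[OF *(3), of "(x, y)" "(x, y')"] by simp
  show "(x, y) \<in> M \<Longrightarrow> (x', y) \<in> M \<Longrightarrow> x = x'" using inj_onD[OF *(4), of "(x, y)" "(x', y)"] by simp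
qed

end

section \<open>Alternating paths for one dimension and one scale\<close>

locale shift_orbit = optimal_matching +
  fixes r a :: nat and \<delta> :: int
  assumes r: "r < d" and a: "a < K" and \<delta>: "\<delta> = 2 ^ a"
begin

text \<open>One full round of the alternating path: two shifts, each followed by a pair of
  \<open>M\<close>. The path stops when a shifted point is unmatched on the relevant side.\<close>

definition succ :: "((nat \<Rightarrow> int) \<times> (nat \<Rightarrow> int)) set" where
  "succ = {(x, x'). \<exists>z. (translate r \<delta> x, z) \<in> M \<and> (x', translate r (- \<delta>) z) \<in> M}"

text \<open>The congruence says that \<open>2 ^ a\<close> is the exact power of two in
  \<open>y r - x r\<close>; it selects the pairs whose potential rises when \<open>x\<close> is
  shifted up.\<close>

definition start :: "(nat \<Rightarrow> int) \<Rightarrow> (nat \<Rightarrow> int) \<Rightarrow> bool" where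
  "start x y \<longleftrightarrow> (x, y) \<in> M \<and> 2 * \<delta> dvd y r - x r - \<delta>"

text \<open>\<open>N\<close> is the matching in which the part of the alternating path already
  traversed has been switched; it misses exactly \<open>x\<close> on the left and \<open>w\<close> on the right, and the pair
  (\<open>x\<close> shifted up, \<open>w\<close>) could be added. \<open>X\<close> and \<open>Y\<close> record the vertices used so far.\<close>

definition state where
  "state x0 N X Y x w \<longleftrightarrow>
     matching B N \<and> fst ` N = fst ` M - {x} \<and> snd ` N = snd ` M - {w} \<and> x \<in> fst ` M \<and> w \<in> snd ` M \<and>
     2 * \<delta> dvd x r - x0 r \<and> translate r \<delta> x \<le> w \<and> Pot M < Pot N + pot K d (translate r \<delta> x, w) \<and>
     x \<notin> X \<and> (\<forall>y\<in>Y. 2 * \<delta> dvd y r - x0 r \<and> (\<exists>u\<in>X. (translate r \<delta> u, translate r \<delta> y) \<in> M)) \<and>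
     (\<forall>u\<in>insert x X. u = x0 \<or> (\<exists>y\<in>Y. (u, y) \<in> M)) \<and>
     (\<forall>u v. (u, v) \<in> M \<longrightarrow> 2 * \<delta> dvd u r - x0 r - \<delta> \<longrightarrow> translate r (- \<delta>) u \<notin> X \<longrightarrow> (u, v) \<in> N) \<and>
     (\<forall>u v. (u, v) \<in> M \<longrightarrow> 2 * \<delta> dvd v r - x0 r \<longrightarrow> v \<notin> Y \<longrightarrow> (u, v) \<in> N)"

lemma \<delta>_pos: "\<delta> > 0" by (simp add: \<delta>)

lemma classes_disjoint:
  assumes "2 * \<delta> dvd m" "2 * \<delta> dvd m - \<delta>" shows False
proof -
  have "2 * \<delta> dvd m - (m - \<delta>)" using assms by (rule dvd_diff)
  then have "2 * \<delta> dvd \<delta>" by simp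
  then show False using \<delta>_pos zdvd_imp_le by fastforce
qed

text \<open>The difference \<open>y r - x r\<close> is nonnegative and an odd multiple of \<delta>,
  hence at least \<delta>.\<close>

lemma start_le:
  assumes "start x y" shows "translate r \<delta> x \<le> y"
proof -
  have le: "x \<le> y" and dv: "2 * \<delta> dvd y r - x r - \<delta>" using assms M_le by (auto simp: start_def)
  have "0 \<le> y r - x r" using le by (simp add: le_fun_def)
  moreover have "\<not> y r - x r < \<delta>"
  proof
    assume "y r - x r < \<delta>"
    then have "2 * \<delta> dvd \<delta> - (y r - x r)" "0 < \<delta> - (y r - x r)"
      using dv by (simp_all add: dvd_diff_commute)
    then have "2 * \<delta> \<le> \<delta> - (y r - x r)" by (rule zdvd_imp_le)
    then show False using \<open>0 \<le> y r - x r\<close> \<delta>_pos by linarith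
  qed
  ultimately show ?thesis using le by (auto simp: le_fun_def translate_apply)
qed

text \<open>Shifting the left end of the starting pair makes the coordinate difference a multiple of
  \<open>2 * \<delta>\<close>. This is the strict gain in potential that all later states
  preserve.\<close>

lemma state_init:
  assumes "start x y"
  shows "state x (M - {(x, y)}) {} {} x y"
proof -
  have xy: "(x, y) \<in> M" "2 * \<delta> dvd y r - x r - \<delta>" using assms by (auto simp: start_def)
  have "Pot M = Pot (M - {(x, y)}) + pot K d (x, y)"
    using sum.remove[OF fin_matching[OF matching_M] xy(1), of "pot K d"] by simp
  moreover have "pot K d (x, y) < pot K d (translate r \<delta> x, y)"
    using pot_shift_less xy(2) r a unfolding \<delta> by blast
  moreover have "\<not> 2 * \<delta> dvd x r - x r - \<delta>" "\<not> 2 * \<delta> dvd y r - x r"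
    using classes_disjoint[of 0] classes_disjoint xy(2) by auto
  ultimately show ?thesis
    unfolding state_def
    using matching_remove[OF matching_M xy(1)] start_le[OF assms]
      image_eqI[OF _ xy(1), of x fst] image_eqI[OF _ xy(1), of y snd]
    by (intro conjI allI impI ballI) auto
qed

text \<open>Rematching \<open>x\<close> shifted up from \<open>z\<close> to \<open>w\<close> frees \<open>z\<close>; were the difference of \<open>(x + \<delta>, z)\<close> not
  divisible by \<open>2 * \<delta>\<close>, closing up with \<open>(x, z)\<close> would raise the potential at equal weight.\<close>

lemma half_step:
  assumes st: "state x0 N X Y x w" and z: "(translate r \<delta> x, z) \<in> M"
  defines "N1 \<equiv> insert (translate r \<delta> x, w) (N - {(translate r \<delta> x, z)})"
  shows "matching B N1" "fst ` N1 = fst ` M - {x}" "snd ` N1 = snd ` M - {z}"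
    "Pot M < Pot N1 + pot K d (translate r \<delta> x, z)"
    "2 * \<delta> dvd z r - x0 r - \<delta>" "x \<le> translate r (- \<delta>) z" "translate r (- \<delta>) z \<in> B"
proof -
  let ?x = "translate r \<delta> x"
  have N: "matching B N" "fst ` N = fst ` M - {x}" "snd ` N = snd ` M - {w}" "x \<in> fst ` M" "w \<in> snd ` M"
    and xc: "2 * \<delta> dvd x r - x0 r" and le: "?x \<le> w" and P: "Pot M < Pot N + pot K d (?x, w)"
    and X: "x \<notin> X"
    and unv: "\<And>u v. (u, v) \<in> M \<Longrightarrow> 2 * \<delta> dvd u r - x0 r - \<delta> \<Longrightarrow> translate r (- \<delta>) u \<notin> X \<Longrightarrow> (u, v) \<in> N"
    using st unfolding state_def by blast+
  \<comment> \<open>The left end lies in the residue class of \<open>x0 r + \<delta>\<close> and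
    \<open>x\<close> is new, so this pair has not been switched yet.\<close>
  have zN: "(?x, z) \<in> N"
    using unv[OF z] xc X by (simp add: translate_apply algebra_simps)
  note rem = matching_remove[OF N(1) zN]
  have xB: "x \<in> B" "w \<in> B" using N(4,5) M_box by auto
  have "?x \<in> fst ` N" "z \<in> snd ` N" using zN by (auto intro: rev_image_eqI)
  note zN' = this
  then have zw: "z \<noteq> w" "?x \<noteq> x" unfolding N(2,3) by auto
  show m1: "matching B N1"
    unfolding N1_def
    by (rule matching_insert) (use rem xB le M_box[OF z] N in auto)
  show f1: "fst ` N1 = fst ` M - {x}" unfolding N1_def using rem(2) insert_Diff[OF zN'(1)] N(2) by simp
  show s1: "snd ` N1 = snd ` M - {z}" using rem(3) N(3,5) zw unfolding N1_def by auto
  have "Pot N1 = pot K d (?x, w) + Pot (N - {(?x, z)})"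
    unfolding N1_def using fin_matching[OF N(1)] N(3) rem(3) by (subst sum_insert_pair) auto
  moreover have "Pot N = pot K d (?x, z) + Pot (N - {(?x, z)})"
    using sum.remove[OF fin_matching[OF N(1)] zN, of "pot K d"] by simp
  ultimately show P1: "Pot M < Pot N1 + pot K d (?x, z)" using P by simp
  have xz: "x r + \<delta> \<le> z r" "\<And>i. i \<noteq> r \<Longrightarrow> x i \<le> z i"
    using M_le[OF z] by (auto simp: le_fun_def translate_apply split: if_splits)
  show "x \<le> translate r (- \<delta>) z"
    using xz by (auto simp: le_fun_def translate_apply)
  show "translate r (- \<delta>) z \<in> B"
    using xz xB(1) M_box(2)[OF z] \<delta>_pos r by (fastforce simp: igrid_def translate_apply)
  have xlez: "x \<le> z"
    unfolding le_fun_def using xz \<delta>_pos by (metis add_less_cancel_left add.right_neutral order.strict_implies_order order_trans)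
  show "2 * \<delta> dvd z r - x0 r - \<delta>"
  proof (rule ccontr)
    assume n: "\<not> 2 * \<delta> dvd z r - x0 r - \<delta>"
    have nd: "\<not> 2 * 2 ^ a dvd translate r (- \<delta>) z r - x r"
    proof
      assume "2 * 2 ^ a dvd translate r (- \<delta>) z r - x r"
      then have "2 * \<delta> dvd (z r - \<delta> - x r) + (x r - x0 r)"
        using xc unfolding \<delta> by (intro dvd_add) (auto simp: translate_apply)
      then show False using n by (simp add: algebra_simps)
    qed
    \<comment> \<open>Shifting both ends down keeps all differences; raising the right end back to
      \<open>z\<close> then cannot lower the potential, by the assumption on the residue
      class.\<close>
    have "pot K d (?x, z) = pot K d (x, translate r (- \<delta>) z)"
      by (rule pot_cong) (simp add: translate_apply)
    also have "\<dots> \<le> pot K d (x, z)"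
      using pot_shift_le[of a "translate r (- \<delta>) z" r x K d, OF nd] by (simp add: \<delta>)
    finally have *: "Pot M < Pot N1 + pot K d (x, z)" using P1 by simp
    have x1: "x \<notin> fst ` N1" "z \<notin> snd ` N1" using f1 s1 by auto
    let ?N = "insert (x, z) N1"
    have m2: "matching B ?N"
      by (rule matching_insert) (use m1 xB M_box[OF z] xlez x1 in auto)
    have "fst ` ?N = fst ` M" "snd ` ?N = snd ` M"
      using f1 s1 N(4) image_eqI[OF _ z, of z snd] by (simp_all add: insert_absorb)
    then have "weight f ?N = weight f M" using weight_eq[OF m2] weight_eq[OF matching_M] by simp
    moreover have "Pot ?N = Pot N1 + pot K d (x, z)"
      using sum_insert_pair[OF fin_matching[OF m1], of x z "pot K d"] x1(1) by simp
    ultimately show False using no_improvement[OF m2] * by simp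
  qed
qed

text \<open>The second half of a round gives \<open>x\<close> the partner \<open>z\<close> shifted
  down and frees \<open>x'\<close>. Removed and added pairs have the same potential as their
  parallel translates, so the strict potential bound carries over. A wrong residue class of
  \<open>x'\<close> would allow closing up with \<open>(x', z)\<close>, at equal weight and higher
  potential.\<close>

lemma full_step:
  assumes st: "state x0 N X Y x w" and start: "start x0 y0"
    and z: "(translate r \<delta> x, z) \<in> M" and x': "(x', translate r (- \<delta>) z) \<in> M"
  shows "\<exists>N' X' Y'. state x0 N' X' Y' x' z"
proof -
  let ?x = "translate r \<delta> x" and ?y = "translate r (- \<delta>) z" and ?x' = "translate r \<delta> x'"
  define N1 where "N1 = insert (?x, w) (N - {(?x, z)})"
  note hs = half_step[OF st z, folded N1_def]
  have N: "fst ` N = fst ` M - {x}" "snd ` N = snd ` M - {w}" "x \<in> fst ` M"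
    and xc: "2 * \<delta> dvd x r - x0 r" 
    and X: "x \<notin> X" and Y: "\<And>y. y \<in> Y \<Longrightarrow> 2 * \<delta> dvd y r - x0 r \<and> (\<exists>u\<in>X. (translate r \<delta> u, translate r \<delta> y) \<in> M)"
    and XY: "\<And>u. u \<in> insert x X \<Longrightarrow> u = x0 \<or> (\<exists>y\<in>Y. (u, y) \<in> M)"
    and unvL: "\<And>u v. (u, v) \<in> M \<Longrightarrow> 2 * \<delta> dvd u r - x0 r - \<delta> \<Longrightarrow> translate r (- \<delta>) u \<notin> X \<Longrightarrow> (u, v) \<in> N"
    and unvR: "\<And>u v. (u, v) \<in> M \<Longrightarrow> 2 * \<delta> dvd v r - x0 r \<Longrightarrow> v \<notin> Y \<Longrightarrow> (u, v) \<in> N"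
    using st unfolding state_def by blast+
  have y0: "(x0, y0) \<in> M" "2 * \<delta> dvd y0 r - x0 r - \<delta>" using start by (auto simp: start_def)
  have yc: "2 * \<delta> dvd ?y r - x0 r" using hs(5) by (simp add: translate_apply algebra_simps)
  have yz: "?y \<noteq> z" using \<delta>_pos by (metis add_0_right translate_apply add_cancel_left_right neg_equal_0_iff_equal less_irrefl)
  \<comment> \<open>Otherwise \<open>z\<close> would have a left partner shifted up from a point of
    \<open>X\<close>, but that partner is the shift of the new point \<open>x\<close>.\<close>
  have yY: "?y \<notin> Y"
  proof
    assume "?y \<in> Y"
    then obtain u where "u \<in> X" "(translate r \<delta> u, z) \<in> M" using Y by fastforce
    then show False using M_right[OF z] X by fastforce
  qed
  have x'N: "(x', ?y) \<in> N" using unvR[OF x' yc yY] .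
  have "x' \<in> fst ` N" "?y \<in> snd ` N" using x'N by (auto intro: rev_image_eqI)
  then have "?y \<noteq> w" "x' \<noteq> x" unfolding N(1,2) by auto
  have x'N1: "(x', ?y) \<in> N1" using x'N yz by (auto simp: N1_def)
  note rem = matching_remove[OF hs(1) x'N1]
  have yN1: "?y \<in> snd ` N1" using x'N1 by (auto intro: rev_image_eqI)
  define N2 where "N2 = insert (x, ?y) (N1 - {(x', ?y)})"
  have xB: "x \<in> B" using N(3) M_box by auto
  have m2: "matching B N2"
    unfolding N2_def
    by (rule matching_insert) (use rem xB hs in auto)
  have f2: "fst ` N2 = fst ` M - {x'}" using rem(2) hs(2) N(3) \<open>x' \<noteq> x\<close> unfolding N2_def by auto
  have s2: "snd ` N2 = snd ` M - {z}" unfolding N2_def using rem(3) insert_Diff[OF yN1] hs(3) by simp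
  have "Pot N2 = pot K d (x, ?y) + Pot (N1 - {(x', ?y)})"
    unfolding N2_def using fin_matching[OF hs(1)] hs(2) rem(2) by (subst sum_insert_pair) auto
  moreover have "Pot N1 = pot K d (x', ?y) + Pot (N1 - {(x', ?y)})"
    using sum.remove[OF fin_matching[OF hs(1)] x'N1, of "pot K d"] by simp
  moreover have "pot K d (?x, z) = pot K d (x, ?y)" "pot K d (?x', z) = pot K d (x', ?y)"
    by (rule pot_cong; simp add: translate_apply)+
  ultimately have P2: "Pot M < Pot N2 + pot K d (?x', z)" using hs(4) by simp
  have x'y: "x' \<le> ?y" using M_le[OF x'] .
  have xyi: "\<And>i. i \<noteq> r \<Longrightarrow> x' i \<le> z i" "x' r \<le> z r - \<delta>"
    using x'y[unfolded le_fun_def] by (metis translate_apply, metis diff_conv_add_uminus translate_apply)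
  have x'z: "?x' \<le> z" "x' \<le> z"
    unfolding le_fun_def translate_apply using xyi \<delta>_pos by (simp_all, smt (verit))
  have x'c: "2 * \<delta> dvd x' r - x0 r"
  proof (rule ccontr)
    assume n: "\<not> 2 * \<delta> dvd x' r - x0 r"
    have nd: "\<not> 2 * 2 ^ a dvd ?y r - x' r"
    proof
      assume "2 * 2 ^ a dvd ?y r - x' r"
      then have "2 * \<delta> dvd (?y r - x0 r) - (?y r - x' r)"
        using yc unfolding \<delta> by (rule dvd_diff[rotated])
      then show False using n by (simp add: algebra_simps)
    qed
    have "pot K d (?x', z) \<le> pot K d (x', z)"
      using pot_shift_le[of a ?y r x' K d, OF nd] \<open>pot K d (?x', z) = pot K d (x', ?y)\<close> by (simp add: \<delta>)
    then have *: "Pot M < Pot N2 + pot K d (x', z)" using P2 by simp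
    have x1: "x' \<notin> fst ` N2" "z \<notin> snd ` N2" using f2 s2 by auto
    let ?N = "insert (x', z) N2"
    have m3: "matching B ?N"
      by (rule matching_insert) (use m2 M_box[OF x'] M_box[OF z] x'z x1 in auto)
    have "fst ` ?N = fst ` M" "snd ` ?N = snd ` M"
      using f2 s2 image_eqI[OF _ x', of x' fst] image_eqI[OF _ z, of z snd] by (simp_all add: insert_absorb)
    then have "weight f ?N = weight f M" using weight_eq[OF m3] weight_eq[OF matching_M] by simp
    moreover have "Pot ?N = Pot N2 + pot K d (x', z)"
      using sum_insert_pair[OF fin_matching[OF m2], of x' z "pot K d"] x1 by simp
    ultimately show False using no_improvement[OF m3] * by simp
  qed
  \<comment> \<open>Each earlier left point other than \<open>x0\<close> has its right partner in
    \<open>Y\<close>, and the partner of \<open>x0\<close> lies in the other residue class; the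
    partner of \<open>x'\<close> does neither.\<close>
  have x'X: "x' \<notin> insert x X"
  proof
    assume "x' \<in> insert x X"
    then consider "x' = x0" | y where "y \<in> Y" "(x', y) \<in> M" using XY by blast
    then show False
    proof cases
      case 1
      then show False using M_left[OF x'] y0 classes_disjoint yc by blast
    next
      case 2
      then show False using M_left[OF x'] yY by blast
    qed
  qed
  have "state x0 N2 (insert x X) (insert ?y Y) x' z"
    unfolding state_def
  proof (intro conjI ballI allI impI)
    fix y assume "y \<in> insert ?y Y"
    then show "2 * \<delta> dvd y r - x0 r" using Y yc by blast
  next
    fix y assume "y \<in> insert ?y Y"
    then show "\<exists>u\<in>insert x X. (translate r \<delta> u, translate r \<delta> y) \<in> M" using Y z by auto
  next
    fix u assume "u \<in> insert x' (insert x X)"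
    then show "u = x0 \<or> (\<exists>y\<in>insert ?y Y. (u, y) \<in> M)" using XY x' by blast
  next
    fix u v assume uv: "(u, v) \<in> M" "2 * \<delta> dvd u r - x0 r - \<delta>" "translate r (- \<delta>) u \<notin> insert x X"
    then have "u \<noteq> ?x" "u \<noteq> x'" using classes_disjoint[OF x'c] by auto
    then show "(u, v) \<in> N2" using unvL uv unfolding N2_def N1_def by auto
  next
    fix u v assume uv: "(u, v) \<in> M" "2 * \<delta> dvd v r - x0 r" "v \<notin> insert ?y Y"
    then have "v \<noteq> z" using classes_disjoint hs(5) by auto
    then show "(u, v) \<in> N2" using unvR uv unfolding N2_def N1_def by auto
  qed (use m2 f2 s2 x' z x'c x'z P2 x'X in \<open>auto intro: rev_image_eqI\<close>)
  then show ?thesis by blast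
qed

section \<open>Disjointness of the paths\<close>

lemma state_of_orbit:
  assumes "start x0 y0" "(x0, x) \<in> succ\<^sup>*"
  shows "\<exists>N X Y w. state x0 N X Y x w"
  using assms(2)
proof (induction rule: rtrancl_induct)
  case base
  then show ?case using state_init[OF assms(1)] by blast
next
  case (step x x')
  then obtain N X Y w z where "state x0 N X Y x w" "(translate r \<delta> x, z) \<in> M" "(x', translate r (- \<delta>) z) \<in> M"
    unfolding succ_def by blast
  then show ?case using full_step[OF _ assms(1)] by blast
qed

lemma succ_inject: "(x, y) \<in> succ \<Longrightarrow> (x', y) \<in> succ \<Longrightarrow> x = x'"
  unfolding succ_def using M_left M_right by (smt (verit) case_prodD mem_Collect_eq translate_inject)

text \<open>A point reached after at least one round has its partner in its own residue class,
  whereas the partner of a starting point lies in the other. In particular no path returns to its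
  start.\<close>

lemma orbit_not_start:
  assumes s: "start x0 y0" and tr: "(x0, x) \<in> succ\<^sup>+" and s': "start x y"
  shows False
proof -
  obtain u where u: "(x0, u) \<in> succ\<^sup>*" "(u, x) \<in> succ" using tr by (meson tranclD2)
  then obtain z where z: "(translate r \<delta> u, z) \<in> M" "(x, translate r (- \<delta>) z) \<in> M" unfolding succ_def by blast
  obtain N X Y w where "state x0 N X Y u w" using state_of_orbit[OF s u(1)] by blast
  then have 1: "2 * \<delta> dvd z r - x0 r - \<delta>" using half_step(5) z(1) by blast
  obtain N X Y w where "state x0 N X Y x w" using state_of_orbit[OF s trancl_into_rtrancl[OF tr]] by blast
  then have 2: "2 * \<delta> dvd x r - x0 r" unfolding state_def by blast
  have "y = translate r (- \<delta>) z" using s' z(2) M_left by (auto simp: start_def)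
  then have "2 * \<delta> dvd (z r - \<delta>) - x r - \<delta>" using s' by (auto simp: start_def translate_apply)
  moreover have "2 * \<delta> dvd (z r - x0 r - \<delta>) - (x r - x0 r)" using 1 2 by (rule dvd_diff)
  ultimately show False using classes_disjoint[of "z r - \<delta> - x r"] by (simp add: algebra_simps)
qed

text \<open>Since \<open>succ\<close> is injective, two paths through a common point can be traced
  back until one start is found on the path of the other; by \<open>orbit_not_start\<close> this
  takes no step.\<close>

lemma orbits_disjoint:
  assumes "start x0 y0" "start x1 y1" "(x0, u) \<in> succ\<^sup>*" "(x1, u) \<in> succ\<^sup>*"
  shows "x0 = x1"
proof -
  have *: "(x0, x1) \<in> succ\<^sup>* \<or> (x1, x0) \<in> succ\<^sup>*"
    using assms(3,4)
  proof (induction arbitrary: rule: rtrancl_induct)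
    case base
    then show ?case by blast
  next
    case (step y z)
    from step.prems show ?case
    proof (cases rule: rtranclE)
      case base
      then show ?thesis using step by (meson rtrancl.rtrancl_into_rtrancl)
    next
      case (step y')
      then show ?thesis using succ_inject \<open>(y, z) \<in> succ\<close> step.IH
        using \<open>(x1, y) \<in> succ\<^sup>* \<Longrightarrow> (x0, x1) \<in> succ\<^sup>* \<or> (x1, x0) \<in> succ\<^sup>*\<close> by blast
    qed
  qed
  then show ?thesis
    using orbit_not_start assms(1,2) by (metis rtranclD)
qed

section \<open>Charging paths to violated shifts\<close>

definition violated :: "(nat \<Rightarrow> int) set" where
  "violated = {x \<in> B. translate r \<delta> x \<in> B \<and> f (translate r \<delta> x) < f x}"

lemma finite_violated: "finite violated"
  unfolding violated_def using finite_igrid by auto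

text \<open>The path is finite and cannot close up, so it breaks off, either because
  \<open>x\<close> shifted up is unmatched on the left or because \<open>z\<close> shifted down is
  unmatched on the right. The last switch then gives a matching of larger potential that exchanges a
  single endpoint, and optimality forces a strict loss of weight, which is a violated shift.\<close>

lemma orbit_has_violation:
  assumes s: "start x0 y0"
  shows "\<exists>x. (x0, x) \<in> succ\<^sup>* \<and> (x \<in> violated \<or> (\<exists>z. (translate r \<delta> x, translate r \<delta> z) \<in> M \<and> z \<in> violated))"
proof -
  let ?O = "{x. (x0, x) \<in> succ\<^sup>*}"
  have OB: "?O \<subseteq> B"
  proof
    fix x assume "x \<in> ?O"
    then obtain N X Y w where "state x0 N X Y x w" using state_of_orbit[OF s] by blast
    then show "x \<in> B" unfolding state_def using M_box by auto
  qed
  have fin: "finite ?O" using OB finite_igrid finite_subset by blast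
  \<comment> \<open>Otherwise \<open>succ\<close> would give an injective self-map of a finite set,
    hence a surjective one, and \<open>x0\<close> would have a predecessor on its own path.\<close>
  have "\<exists>x\<in>?O. \<forall>x'. (x, x') \<notin> succ"
  proof (rule ccontr)
    assume "\<not> (\<exists>x\<in>?O. \<forall>x'. (x, x') \<notin> succ)"
    then have "\<forall>x\<in>?O. \<exists>x'. (x, x') \<in> succ" by blast
    then have "\<exists>g. \<forall>x\<in>?O. (x, g x) \<in> succ" by (rule bchoice)
    then obtain g where g: "\<forall>x\<in>?O. (x, g x) \<in> succ" by (rule exE)
    have "inj_on g ?O"
    proof (rule inj_onI)
      fix x y assume "x \<in> ?O" "y \<in> ?O" "g x = g y"
      then have "(x, g x) \<in> succ" "(y, g x) \<in> succ" using g by auto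
      then show "x = y" by (rule succ_inject)
    qed
    moreover have "g ` ?O \<subseteq> ?O" using g by (auto intro: rtrancl_into_rtrancl)
    ultimately have "g ` ?O = ?O" using fin by (simp add: endo_inj_surj)
    moreover have "x0 \<in> ?O" by simp
    ultimately have "x0 \<in> g ` ?O" by simp
    then obtain u where "u \<in> ?O" "g u = x0" by blast
    then have "(x0, u) \<in> succ\<^sup>*" "(u, x0) \<in> succ" using g by auto
    then have "(x0, x0) \<in> succ\<^sup>+" by (rule rtrancl_into_trancl1)
    then show False using orbit_not_start s by blast
  qed
  then obtain x where x: "(x0, x) \<in> succ\<^sup>*" "\<And>x'. (x, x') \<notin> succ" by blast
  then obtain N X Y w where st: "state x0 N X Y x w" using state_of_orbit[OF s] by blast
  let ?x = "translate r \<delta> x"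
  have N: "matching B N" "fst ` N = fst ` M - {x}" "snd ` N = snd ` M - {w}" "x \<in> fst ` M" "w \<in> snd ` M"
    and le: "?x \<le> w" and P: "Pot M < Pot N + pot K d (?x, w)"
    using st unfolding state_def by blast+
  have B: "x \<in> B" "w \<in> B" using N(4,5) M_box by auto
  have finM: "finite M" using fin_matching matching_M by blast
  show ?thesis
  proof (cases "?x \<in> fst ` M")
    case False
    have xB: "?x \<in> B"
    proof -
      have "x r + \<delta> \<le> w r" using le by (metis le_fun_def translate_apply)
      then show ?thesis using B \<delta>_pos r by (fastforce simp: igrid_def translate_apply)
    qed
    let ?N = "insert (?x, w) N"
    have m: "matching B ?N"
      by (rule matching_insert) (use N xB B le False in auto)
    have "fst ` ?N = insert ?x (fst ` M - {x})" "snd ` ?N = snd ` M" using N by auto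
    then have "weight f ?N = f ?x + (sum f (fst ` M) - f x) - sum f (snd ` M)"
      using weight_eq[OF m] False finM N(4) by (simp add: sum_diff1)
    then have *: "weight f ?N = weight f M + (f ?x - f x)"
      using weight_eq[OF matching_M] by simp
    have "Pot ?N = pot K d (?x, w) + Pot N"
      using sum_insert_pair[OF fin_matching[OF N(1)], of ?x w "pot K d"] N(3) by simp
    then have "\<not> weight f M \<le> weight f ?N" using no_improvement[OF m] P by auto
    then have "x \<in> violated" using * B xB by (simp add: violated_def)
    then show ?thesis using x(1) by blast
  next
    case True
    then obtain z where z: "(?x, z) \<in> M" by force
    let ?y = "translate r (- \<delta>) z"
    define N1 where "N1 = insert (?x, w) (N - {(?x, z)})"
    note hs = half_step[OF st z, folded N1_def]
    have ny: "?y \<notin> snd ` M" using x(2) z by (force simp: succ_def)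
    let ?N = "insert (x, ?y) N1"
    have m: "matching B ?N"
      by (rule matching_insert) (use hs B ny in auto)
    have "fst ` ?N = fst ` M" "snd ` ?N = insert ?y (snd ` M - {z})" using hs N by auto
    then have "weight f ?N = sum f (fst ` M) - (f ?y + (sum f (snd ` M) - f z))"
      using weight_eq[OF m] ny finM z by (simp add: sum_diff1 rev_image_eqI)
    then have *: "weight f ?N = weight f M + (f z - f ?y)"
      using weight_eq[OF matching_M] by simp
    have "Pot ?N = pot K d (x, ?y) + Pot N1"
      using sum_insert_pair[OF fin_matching[OF hs(1)], of x ?y "pot K d"] hs(2) by simp
    moreover have "pot K d (?x, z) = pot K d (x, ?y)"
      by (rule pot_cong; simp add: translate_apply)
    ultimately have "\<not> weight f M \<le> weight f ?N" using no_improvement[OF m] hs(4) by auto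
    then have "?y \<in> violated" using * hs(7) M_box[OF z] by (simp add: violated_def)
    then show ?thesis using x(1) z by (intro exI[of _ x]) (auto intro!: exI[of _ ?y])
  qed
qed

text \<open>The factor 2 counts the two ways in which a path may break off; the Boolean in the
  charge \<open>h\<close> records which one. Together with the violated point it determines a point
  of the path, by \<open>M_right\<close>, and then the start, by disjointness.\<close>

lemma card_starts: "card {x. \<exists>y. start x y} \<le> 2 * card violated"
proof -
  let ?S = "{x. \<exists>y. start x y}"
  let ?P = "\<lambda>x0 p. \<exists>x. (x0, x) \<in> succ\<^sup>* \<and> snd p \<in> violated \<and>
      (if fst p then x = snd p else (translate r \<delta> x, translate r \<delta> (snd p)) \<in> M)"
  have "\<forall>x0\<in>?S. \<exists>p. ?P x0 p"
  proof
    fix x0 assume "x0 \<in> ?S"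
    then obtain y0 where "start x0 y0" by blast
    from orbit_has_violation[OF this] obtain x where
      x: "(x0, x) \<in> succ\<^sup>*" "x \<in> violated \<or> (\<exists>z. (translate r \<delta> x, translate r \<delta> z) \<in> M \<and> z \<in> violated)" by blast
    from x(2) show "\<exists>p. ?P x0 p"
    proof
      assume "x \<in> violated"
      then show ?thesis using x(1) by (intro exI[of _ "(True, x)"]) auto
    next
      assume "\<exists>z. (translate r \<delta> x, translate r \<delta> z) \<in> M \<and> z \<in> violated"
      then obtain z where "(translate r \<delta> x, translate r \<delta> z) \<in> M \<and> z \<in> violated" by blast
      then show ?thesis using x(1) by (intro exI[of _ "(False, z)"]) auto
    qed
  qed
  then obtain h where h: "\<And>x0. x0 \<in> ?S \<Longrightarrow> ?P x0 (h x0)" by metis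
  have "inj_on h ?S"
  proof (rule inj_onI)
    fix x0 x1 assume S: "x0 \<in> ?S" "x1 \<in> ?S" and eq: "h x0 = h x1"
    obtain x where x: "(x0, x) \<in> succ\<^sup>*"
      "if fst (h x0) then x = snd (h x0) else (translate r \<delta> x, translate r \<delta> (snd (h x0))) \<in> M"
      using h[OF S(1)] by blast
    obtain x' where x': "(x1, x') \<in> succ\<^sup>*"
      "if fst (h x0) then x' = snd (h x0) else (translate r \<delta> x', translate r \<delta> (snd (h x0))) \<in> M"
      using h[OF S(2)] eq by metis
    have "x = x'"
    proof (cases "fst (h x0)")
      case False
      then show ?thesis using x(2) x'(2) M_right[of "translate r \<delta> x" _ "translate r \<delta> x'"] by simp
    qed (use x(2) x'(2) in simp)
    then show "x0 = x1" using orbits_disjoint x(1) x'(1) S by blast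
  qed
  moreover have "h ` ?S \<subseteq> UNIV \<times> violated" 
  proof
    fix p assume "p \<in> h ` ?S"
    then obtain x0 where "x0 \<in> ?S" "p = h x0" by blast
    then have "snd p \<in> violated" using h by blast
    then show "p \<in> UNIV \<times> violated" by (simp add: mem_Times_iff)
  qed
  ultimately have "card ?S \<le> card ((UNIV :: bool set) \<times> violated)"
    using finite_violated by (intro card_inj_on_le) auto
  then show ?thesis by (simp add: card_cartesian_product)
qed

end

section \<open>All dimensions and scales together\<close>

lemma odd_part:
  fixes m :: int
  assumes "m > 0"
  obtains a where "2 ^ a \<le> m" "2 * 2 ^ a dvd m - 2 ^ a"
proof -
  obtain q where q: "m = 2 ^ multiplicity 2 m * q" "\<not> 2 dvd q"
    using multiplicity_decompose'[of m 2] assms by auto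
  let ?a = "multiplicity 2 m"
  have "m - 2 ^ ?a = 2 ^ ?a * (q - 1)" using q(1) by (simp add: algebra_simps)
  moreover have "2 dvd q - 1" using q(2) by simp
  ultimately have "2 * 2 ^ ?a dvd m - 2 ^ ?a" by (metis mult.commute dvd_refl mult_dvd_mono)
  moreover have "2 ^ ?a dvd m" using q(1) by (metis dvd_triv_left)
  then have "2 ^ ?a \<le> m" using assms zdvd_imp_le by blast
  ultimately show ?thesis using that by blast
qed

text \<open>\<open>U\<close> consists of the endpoints of the nondegenerate pairs of an optimal
  matching. Each such pair starts a path for some dimension and scale, a violated shift is charged
  by at most two paths, and a pair has two endpoints; hence the factor 4.\<close>

lemma violated_pairs_bound:
  fixes f :: "(nat \<Rightarrow> int) \<Rightarrow> real"
  assumes A: "n \<le> 2 ^ A"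
  obtains U where "U \<subseteq> igrid n d"
    "card U \<le> 4 * (\<Sum>r<d. \<Sum>a<A. card {x \<in> igrid n d. translate r (2 ^ a) x \<in> igrid n d \<and> f (translate r (2 ^ a) x) < f x})"
    "\<And>x y. x \<in> igrid n d - U \<Longrightarrow> y \<in> igrid n d - U \<Longrightarrow> x \<le> y \<Longrightarrow> f x \<le> f y"
proof -
  let ?B = "igrid n d"
  obtain M where M: "matching ?B M"
    "\<And>M'. matching ?B M' \<Longrightarrow> weight f M' \<le> weight f M"
    "\<And>M'. matching ?B M' \<Longrightarrow> weight f M' = weight f M \<Longrightarrow> sum (pot A d) M' \<le> sum (pot A d) M"
    using ex_optimal_matching[OF finite_igrid, of n d f "pot A d"] by blast
  interpret optimal_matching n d A f M using M by unfold_locales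
  have finM: "finite M" using fin_matching M(1) by blast
  define M0 where "M0 = {p \<in> M. fst p \<noteq> snd p}"
  define U where "U = fst ` M0 \<union> snd ` M0"
  have finM0: "finite M0" unfolding M0_def using finM by simp
  let ?S = "\<lambda>r a. {x. \<exists>y. shift_orbit.start M r (2 ^ a) x y}"
  have so: "shift_orbit n d A f M r a (2 ^ a)" if "r < d" "a < A" for r a
    using that by unfold_locales auto
  have sub: "fst ` M0 \<subseteq> (\<Union>(r, a)\<in>{..<d} \<times> {..<A}. ?S r a)"
  proof
    fix x assume "x \<in> fst ` M0"
    then obtain y where xy: "(x, y) \<in> M" "x \<noteq> y" unfolding M0_def by auto
    have B: "x \<in> ?B" "y \<in> ?B" using M_box[OF xy(1)] by auto
    obtain r where r: "x r \<noteq> y r" using xy(2) by blast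
    have "r < d"
    proof (rule ccontr)
      assume "\<not> r < d"
      then have "x r = 0" "y r = 0" using B by (auto simp: igrid_def)
      then show False using r by simp
    qed
    have "x r \<le> y r" using M_le[OF xy(1)] by (simp add: le_fun_def)
    then have "0 < y r - x r" using r by simp
    then obtain a where a: "2 ^ a \<le> y r - x r" "2 * 2 ^ a dvd y r - x r - 2 ^ a" by (rule odd_part)
    \<comment> \<open>Grid points differ by less than \<open>n\<close> in a coordinate, so only
      scales below \<open>A\<close> occur.\<close>
    have "1 \<le> x r" "y r \<le> int n" using B \<open>r < d\<close> by (auto simp: igrid_def)
    then have "(2::int) ^ a < int n" using a(1) by linarith
    also have "\<dots> \<le> 2 ^ A" using A by (metis of_nat_le_iff of_nat_numeral of_nat_power)
    finally have "a < A" by (simp add: power_strict_increasing_iff)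
    have "shift_orbit.start M r (2 ^ a) x y"
      using a(2) xy(1) shift_orbit.start_def[OF so[OF \<open>r < d\<close> \<open>a < A\<close>]] by simp
    then show "x \<in> (\<Union>(r, a)\<in>{..<d} \<times> {..<A}. ?S r a)" using \<open>r < d\<close> \<open>a < A\<close> by auto
  qed
  have finS: "finite (?S r a)" if "r < d" "a < A" for r a
    by (rule finite_subset[of _ "fst ` M"])
      (use finM shift_orbit.start_def[OF so[OF that]] in \<open>auto intro: rev_image_eqI\<close>)
  let ?V = "\<lambda>r a. {x \<in> ?B. translate r (2 ^ a) x \<in> ?B \<and> f (translate r (2 ^ a) x) < f x}"
  have S: "card (?S r a) \<le> 2 * card (?V r a)" if "r < d" "a < A" for r a
    using shift_orbit.card_starts[OF so[OF that]] shift_orbit.violated_def[OF so[OF that]] by simp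
  have "card M0 = card (fst ` M0)"
    using M(1) by (intro card_image[symmetric]) (auto simp: matching_def M0_def intro: inj_on_subset)
  also have "\<dots> \<le> card (\<Union>(r, a)\<in>{..<d} \<times> {..<A}. ?S r a)"
    by (rule card_mono[OF _ sub]) (use finS in auto)
  also have "\<dots> \<le> (\<Sum>(r, a)\<in>{..<d} \<times> {..<A}. card (?S r a))"
    using card_UN_le[of "{..<d} \<times> {..<A}" "\<lambda>(r, a). ?S r a"] by (simp add: case_prod_unfold)
  also have "\<dots> \<le> (\<Sum>(r, a)\<in>{..<d} \<times> {..<A}. 2 * card (?V r a))"
    by (rule sum_mono) (use S in auto)
  also have "\<dots> = 2 * (\<Sum>r<d. \<Sum>a<A. card (?V r a))"
    by (simp add: sum.cartesian_product sum_distrib_left case_prod_unfold)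
  finally have "card M0 \<le> 2 * (\<Sum>r<d. \<Sum>a<A. card (?V r a))" .
  moreover have "card U \<le> card M0 + card M0"
    unfolding U_def using card_Un_le card_image_le[OF finM0] by (meson add_mono order_trans)
  ultimately have "card U \<le> 4 * (\<Sum>r<d. \<Sum>a<A. card (?V r a))" by simp
  moreover have "U \<subseteq> ?B"
    unfolding U_def M0_def using M(1) by (auto simp: matching_def)
  moreover have "f x \<le> f y" if xy: "x \<in> ?B - U" "y \<in> ?B - U" "x \<le> y" for x y
  proof (rule ccontr)
    assume "\<not> f x \<le> f y"
    \<comment> \<open>As first component \<open>x\<close>, and as second component \<open>y\<close>,
      can only occur in a degenerate pair, being outside \<open>U\<close>. Dropping these pairs
      costs no weight and makes room for the violating pair.\<close>
    define M' where "M' = {p \<in> M. fst p \<noteq> x \<and> snd p \<noteq> y}"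
    have m': "matching ?B M'" using M(1) by (rule matching_subset) (auto simp: M'_def)
    have "weight f M' = weight f M"
      unfolding weight_def
    proof (rule sum.mono_neutral_left)
      show "\<forall>p\<in>M - M'. f (fst p) - f (snd p) = 0"
        using xy(1,2) unfolding M'_def U_def M0_def by (auto simp: image_iff)
    qed (use finM in \<open>auto simp: M'_def\<close>)
    moreover have "weight f (insert (x, y) M') = f x - f y + weight f M'"
      unfolding weight_def using finM by (subst sum.insert) (auto simp: M'_def)
    moreover have "matching ?B (insert (x, y) M')"
      by (rule matching_insert[OF m']) (use xy in \<open>auto simp: M'_def\<close>)
    ultimately show False using M(2) \<open>\<not> f x \<le> f y\<close> by fastforce
  qed
  ultimately show ?thesis using that by blast
qed

subsection \<open>From monotonicity to unateness\<close>

text \<open>\<open>b\<close> is the assumed direction, up if true; a violation is recorded by its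
  lower endpoint.\<close>

definition bad :: "nat \<Rightarrow> nat \<Rightarrow> (nat list \<Rightarrow> real) \<Rightarrow> bool \<Rightarrow> nat \<Rightarrow> nat \<Rightarrow> nat list set" where
  "bad n d f b r m = {x \<in> hypergrid n d. x ! r + m \<le> n \<and>
     (if b then f (x[r := x ! r + m]) < f x else f x < f (x[r := x ! r + m]))}"

lemma finite_hypergrid: "finite (hypergrid n d)"
  unfolding hypergrid_def using finite_lists_length_eq[of "{1..n}" d] by (simp add: conj_commute)

lemma hypergrid_iff: "x \<in> hypergrid n d \<longleftrightarrow> length x = d \<and> (\<forall>i<d. 1 \<le> x ! i \<and> x ! i \<le> n)"
  unfolding hypergrid_def by (auto simp: set_conv_nth)

text \<open>Reflecting the dimensions with \<open>up\<close> false reduces unateness with prescribed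
  directions to monotonicity.\<close>

definition decode :: "nat \<Rightarrow> nat \<Rightarrow> (nat \<Rightarrow> bool) \<Rightarrow> (nat \<Rightarrow> int) \<Rightarrow> nat list" where
  "decode n d up z = map (\<lambda>i. nat (if up i then z i else int n + 1 - z i)) [0..<d]"

definition encode :: "nat \<Rightarrow> nat \<Rightarrow> (nat \<Rightarrow> bool) \<Rightarrow> nat list \<Rightarrow> nat \<Rightarrow> int" where
  "encode n d up x = (\<lambda>i. if i < d then if up i then int (x ! i) else int n + 1 - int (x ! i) else 0)"

lemma decode_nth: "i < d \<Longrightarrow> decode n d up z ! i = nat (if up i then z i else int n + 1 - z i)"
  by (simp add: decode_def)

lemma decode_length [simp]: "length (decode n d up z) = d"
  by (simp add: decode_def)

lemma decode_in: "z \<in> igrid n d \<Longrightarrow> decode n d up z \<in> hypergrid n d"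
  by (auto simp: hypergrid_iff decode_nth igrid_def nat_le_iff)

lemma encode_in: "x \<in> hypergrid n d \<Longrightarrow> encode n d up x \<in> igrid n d"
  by (auto simp: hypergrid_iff encode_def igrid_def)

lemma decode_encode: "x \<in> hypergrid n d \<Longrightarrow> decode n d up (encode n d up x) = x"
  by (rule nth_equalityI) (auto simp: hypergrid_iff decode_nth encode_def)

lemma encode_decode: "z \<in> igrid n d \<Longrightarrow> encode n d up (decode n d up z) = z"
  by (rule ext) (auto simp: encode_def decode_nth igrid_def)

lemma inj_on_decode: "inj_on (decode n d up) (igrid n d)"
  by (rule inj_on_inverseI[of _ "encode n d up"]) (rule encode_decode)

text \<open>In a reflected dimension the shift by \<open>m\<close> goes down in the original
  coordinates, so there the shifted point is the lower end that \<open>bad\<close> records.\<close>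

lemma card_violated_le_bad:
  fixes f :: "nat list \<Rightarrow> real"
  assumes r: "r < d"
  shows "card {z \<in> igrid n d. translate r (int m) z \<in> igrid n d \<and>
      f (decode n d up (translate r (int m) z)) < f (decode n d up z)} \<le> card (bad n d f (up r) r m)"
    (is "card ?V \<le> _")
proof (rule card_inj_on_le)
  let ?h = "\<lambda>z. if up r then decode n d up z else decode n d up (translate r (int m) z)"
  show "inj_on ?h ?V"
  proof (rule inj_onI)
    fix x y assume "x \<in> ?V" "y \<in> ?V" "?h x = ?h y"
    then show "x = y"
      using inj_onD[OF inj_on_decode[of n d up], of x y]
        inj_onD[OF inj_on_decode[of n d up], of "translate r (int m) x" "translate r (int m) y"]
      by (auto split: if_splits)
  qed
  show "?h ` ?V \<subseteq> bad n d f (up r) r m"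
  proof
    fix x assume "x \<in> ?h ` ?V"
    then obtain z where z: "z \<in> igrid n d" "translate r (int m) z \<in> igrid n d"
      "f (decode n d up (translate r (int m) z)) < f (decode n d up z)" and x: "x = ?h z" by blast
    have zr: "1 \<le> z r" "z r + int m \<le> int n" using z(1,2) r by (auto simp: igrid_def translate_apply)
    show "x \<in> bad n d f (up r) r m"
    proof (cases "up r")
      case True
      have "x[r := x ! r + m] = decode n d up (translate r (int m) z)"
        by (rule nth_equalityI) (use x True zr r in \<open>auto simp: decode_nth translate_apply nth_list_update nat_add_distrib\<close>)
      moreover have "x ! r + m \<le> n" using x True zr r by (simp add: decode_nth)
      ultimately show ?thesis using True x z decode_in by (simp add: bad_def)
    next
      case False
      have "x[r := x ! r + m] = decode n d up z"
        by (rule nth_equalityI) (use x False zr r in \<open>auto simp: decode_nth translate_apply nth_list_update\<close>)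
      moreover have "x ! r + m \<le> n" using x False zr r by (simp add: decode_nth translate_apply)
      ultimately show ?thesis using False x z decode_in by (simp add: bad_def)
    qed
  qed
qed (simp add: bad_def finite_hypergrid)

lemma encode_step:
  assumes "x \<in> hypergrid n d" "i < d"
  shows "if up i then encode n d up x \<le> encode n d up (step x i) else encode n d up (step x i) \<le> encode n d up x"
  using assms by (auto simp: encode_def step_def le_fun_def nth_list_update hypergrid_iff)

text \<open>For an arbitrary choice \<open>up\<close>, the values of \<open>f\<close> outside
  \<open>U\<close> extend to a function monotone in these directions, so \<open>f\<close> differs
  only on \<open>U\<close> from a unate function.\<close>

lemma far_from_unate_bound:
  assumes far: "far_from_unate n d \<epsilon> f" and A: "n \<le> 2 ^ A" and n: "0 < n"
  shows "\<epsilon> * card (hypergrid n d) \<le> 4 * (\<Sum>r<d. \<Sum>a<A. card (bad n d f (up r) r (2 ^ a)))"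
proof -
  let ?B = "igrid n d" and ?f = "\<lambda>z. f (decode n d up z)"
  obtain U where U: "U \<subseteq> ?B"
    "card U \<le> 4 * (\<Sum>r<d. \<Sum>a<A. card {x \<in> ?B. translate r (2 ^ a) x \<in> ?B \<and> ?f (translate r (2 ^ a) x) < ?f x})"
    "\<And>x y. x \<in> ?B - U \<Longrightarrow> y \<in> ?B - U \<Longrightarrow> x \<le> y \<Longrightarrow> ?f x \<le> ?f y"
    using violated_pairs_bound[OF A, of d ?f] by blast
  have "card U \<le> 4 * (\<Sum>r<d. \<Sum>a<A. card (bad n d f (up r) r (2 ^ a)))"
    by (rule order_trans[OF U(2)], intro mult_left_mono sum_mono)
      (use card_violated_le_bad[of _ d n "2 ^ _" f up] in simp_all)
  moreover
  \<comment> \<open>A default for points with nothing below them outside \<open>U\<close>; being a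
    minimum, it does not affect the maximum elsewhere.\<close>
  define c where "c = Min (?f ` ?B)"
  define h where "h = (\<lambda>z. Max (insert c (?f ` {u \<in> ?B - U. u \<le> z})))"
  define g where "g = (\<lambda>x. h (encode n d up x))"
  have fin: "finite (insert c (?f ` {u \<in> ?B - U. u \<le> z}))" for z
    using finite_igrid by simp
  have mono: "h z \<le> h z'" if "z \<le> z'" for z z'
    unfolding h_def using that by (intro Max_mono fin) (auto intro: order_trans)
  have h_eq: "h z = ?f z" if "z \<in> ?B - U" for z
    unfolding h_def
  proof (rule Max_eqI[OF fin])
    fix v assume "v \<in> insert c (?f ` {u \<in> ?B - U. u \<le> z})"
    then show "v \<le> ?f z"
      using U(3) that finite_igrid by (auto simp: c_def)
  qed (use that in auto)
  have "unate n d g"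
    unfolding unate_def
  proof (intro exI[of _ up] allI impI)
    fix i x assume "i < d" "x \<in> hypergrid n d"
    then show "if up i then g x \<le> g (step x i) else g (step x i) \<le> g x"
      using encode_step[of x n d i up] mono by (auto simp: g_def split: if_splits)
  qed
  then have "\<epsilon> \<le> grid_dist n d f g" using far by (simp add: far_from_unate_def)
  moreover have "card {x \<in> hypergrid n d. f x \<noteq> g x} \<le> card U"
  proof -
    have "{x \<in> hypergrid n d. f x \<noteq> g x} \<subseteq> decode n d up ` U"
    proof
      fix x assume "x \<in> {x \<in> hypergrid n d. f x \<noteq> g x}"
      then have x: "x \<in> hypergrid n d" "f x \<noteq> g x" by auto
      then have "encode n d up x \<in> U"
        using h_eq[of "encode n d up x"] encode_in decode_encode by (auto simp: g_def)
      then show "x \<in> decode n d up ` U" using decode_encode[OF x(1)] by (metis imageI)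
    qed
    moreover have "finite U" using U(1) finite_igrid finite_subset by blast
    ultimately show ?thesis by (meson card_image_le card_mono finite_imageI order_trans)
  qed
  moreover have "card (hypergrid n d) > 0"
  proof -
    have "replicate d 1 \<in> hypergrid n d" using n by (auto simp: hypergrid_def)
    then show ?thesis using finite_hypergrid card_gt_0_iff by blast
  qed
  ultimately show ?thesis
    unfolding grid_dist_def by (simp add: pos_le_divide_eq flip: of_nat_sum)
qed

subsection \<open>Randomized query trees\<close>

primrec cost :: "qtree \<Rightarrow> (nat list \<Rightarrow> real) \<Rightarrow> nat" where
  "cost (Output b) f = 0"
| "cost (Query x k) f = Suc (cost (k (f x)) f)"

text \<open>Membership of the queries is tracked apart from their number, since only truncated trees
  have to meet the budget.\<close>

primrec queries_in :: "nat list set \<Rightarrow> qtree \<Rightarrow> bool" where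
  "queries_in D (Output b) \<longleftrightarrow> True"
| "queries_in D (Query x k) \<longleftrightarrow> x \<in> D \<and> (\<forall>v. queries_in D (k v))"

text \<open>An exhausted budget leads to acceptance, which keeps the error one-sided.\<close>

primrec truncate :: "qtree \<Rightarrow> nat \<Rightarrow> qtree" where
  "truncate (Output b) q = Output b"
| "truncate (Query x k) q = (case q of 0 \<Rightarrow> Output True | Suc q' \<Rightarrow> Query x (\<lambda>v. truncate (k v) q'))"

primrec both :: "qtree \<Rightarrow> qtree \<Rightarrow> qtree" where
  "both (Output b) t = (if b then t else Output False)"
| "both (Query x k) t = Query x (\<lambda>v. both (k v) t)"

lemma run_truncate: "run (truncate t q) f \<longleftrightarrow> run t f \<or> q < cost t f"
  by (induction t arbitrary: q) (auto split: nat.split)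

lemma within_budget_truncate: "queries_in D t \<Longrightarrow> within_budget D q (truncate t q)"
  by (induction t arbitrary: q) (auto split: nat.split intro: within_budget.intros)

lemma run_both: "run (both s t) f \<longleftrightarrow> run s f \<and> run t f"
  by (induction s) auto

lemma cost_both: "cost (both s t) f \<le> cost s f + cost t f"
  by (induction s) auto

lemma queries_in_both: "queries_in D s \<Longrightarrow> queries_in D t \<Longrightarrow> queries_in D (both s t)"
  by (induction s) auto

section \<open>Expectations, repetition and truncation\<close>

lemma expectation_bind:
  fixes h :: "'b \<Rightarrow> real"
  assumes "finite (set_pmf p)" "\<And>x. x \<in> set_pmf p \<Longrightarrow> finite (set_pmf (F x))"
  shows "measure_pmf.expectation (bind_pmf p F) h
       = measure_pmf.expectation p (\<lambda>x. measure_pmf.expectation (F x) h)"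
  using pmf_expectation_bind[of "set_pmf p" F p h] assms
  by (simp add: integral_measure_pmf_real[of "set_pmf p"] mult.commute)

abbreviation "\<E> \<equiv> measure_pmf.expectation"

primrec repeat :: "nat \<Rightarrow> qtree pmf \<Rightarrow> qtree pmf" where
  "repeat 0 p = return_pmf (Output True)"
| "repeat (Suc m) p = bind_pmf p (\<lambda>s. map_pmf (both s) (repeat m p))"

lemma finite_repeat: "finite (set_pmf p) \<Longrightarrow> finite (set_pmf (repeat m p))"
  by (induction m) auto

lemma repeat_invariant:
  assumes "\<And>t. t \<in> set_pmf p \<Longrightarrow> P t" "P (Output True)" "\<And>s t. P s \<Longrightarrow> P t \<Longrightarrow> P (both s t)"
  shows "t \<in> set_pmf (repeat m p) \<Longrightarrow> P t"
  using assms by (induction m arbitrary: t) auto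

lemma accept_prob_eq: "accept_prob p f = \<E> p (\<lambda>t. of_bool (run t f))"
proof -
  have "(\<lambda>t. of_bool (run t f)) = indicat_real {t. run t f}" by (auto simp: indicator_def)
  then show ?thesis by (simp add: accept_prob_def)
qed

lemma accept_repeat:
  assumes "finite (set_pmf p)"
  shows "accept_prob (repeat m p) f = accept_prob p f ^ m"
proof (induction m)
  case 0
  then show ?case by (simp add: accept_prob_eq)
next
  case (Suc m)
  have "accept_prob (repeat (Suc m) p) f
      = \<E> p (\<lambda>s. \<E> (repeat m p) (\<lambda>t. of_bool (run s f) * of_bool (run t f)))"
    unfolding accept_prob_eq repeat.simps
    by (subst expectation_bind) (auto simp: assms finite_repeat run_both of_bool_conj)
  also have "\<dots> = accept_prob p f * accept_prob (repeat m p) f"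
    by (simp add: accept_prob_eq)
  finally show ?case using Suc by simp
qed

lemma cost_repeat:
  assumes "finite (set_pmf p)"
  shows "\<E> (repeat m p) (\<lambda>t. cost t f) \<le> m * \<E> p (\<lambda>t. cost t f)"
proof (induction m)
  case 0
  then show ?case by simp
next
  case (Suc m)
  note fin = finite_repeat[OF assms, of m]
  have I: "integrable (measure_pmf p) g" "integrable (measure_pmf (repeat m p)) g" for g :: "qtree \<Rightarrow> real"
    using assms fin by (auto intro: integrable_measure_pmf_finite)
  have "\<E> (repeat (Suc m) p) (\<lambda>t. cost t f) = \<E> p (\<lambda>s. \<E> (repeat m p) (\<lambda>t. cost (both s t) f))"
    by (simp, subst expectation_bind) (auto simp: assms fin)
  also have "\<dots> \<le> \<E> p (\<lambda>s. \<E> (repeat m p) (\<lambda>t. real (cost s f) + real (cost t f)))"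
    using cost_both by (intro integral_mono I) (simp flip: of_nat_add)
  also have "\<dots> = \<E> p (\<lambda>s. cost s f) + \<E> (repeat m p) (\<lambda>t. cost t f)"
    using I by simp
  finally show ?case using Suc by (simp add: algebra_simps)
qed

text \<open>Markov's inequality: truncation changes the answer only if the cost is at least
  \<open>q + 1\<close>, which has probability at most 1/6.\<close>

lemma accept_truncate:
  assumes fin: "finite (set_pmf p)" and c: "\<E> p (\<lambda>t. cost t f) \<le> q / 6"
  shows "accept_prob (map_pmf (\<lambda>t. truncate t q) p) f \<le> accept_prob p f + 1 / 6"
proof -
  have I: "integrable (measure_pmf p) g" for g :: "qtree \<Rightarrow> real"
    using fin by (auto intro: integrable_measure_pmf_finite)
  have "accept_prob (map_pmf (\<lambda>t. truncate t q) p) f \<le> \<E> p (\<lambda>t. of_bool (run t f) + cost t f / (q + 1))"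
    unfolding accept_prob_eq integral_map_pmf
    by (intro integral_mono I) (auto simp: run_truncate field_simps of_bool_def)
  also have "\<dots> = accept_prob p f + \<E> p (\<lambda>t. cost t f) / (q + 1)"
    using I by (simp add: accept_prob_eq)
  also have "\<E> p (\<lambda>t. cost t f) / (q + 1) \<le> 1 / 6"
    using c by (simp add: field_simps)
  finally show ?thesis by simp
qed

section \<open>One trial in one dimension\<close>

text \<open>The Boolean \<open>b\<close> records whether the pair seen before was increasing.\<close>

primrec search :: "(nat list \<times> nat list) pmf \<Rightarrow> bool \<Rightarrow> nat \<Rightarrow> qtree pmf" where
  "search D b 0 = return_pmf (Output True)"
| "search D b (Suc k) = bind_pmf D (\<lambda>(x, y). map_pmf (\<lambda>t.
     Query x (\<lambda>u. Query y (\<lambda>v. if u = v then t else Output ((u < v) = b)))) (search D b k))"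

text \<open>Both continuations are drawn in advance because a randomized algorithm is a distribution
  over deterministic trees; at most one of them is run.\<close>

definition trial :: "(nat list \<times> nat list) pmf \<Rightarrow> nat \<Rightarrow> qtree pmf" where
  "trial D k = bind_pmf D (\<lambda>(x, y). bind_pmf (search D True k) (\<lambda>s. map_pmf (\<lambda>t.
     Query x (\<lambda>u. Query y (\<lambda>v. if u = v then Output True else if u < v then s else t))) (search D False k)))"

definition p_inc :: "(nat list \<times> nat list) pmf \<Rightarrow> (nat list \<Rightarrow> real) \<Rightarrow> real" where
  "p_inc D f = \<E> D (\<lambda>p. of_bool (f (fst p) < f (snd p)))"

definition p_dec :: "(nat list \<times> nat list) pmf \<Rightarrow> (nat list \<Rightarrow> real) \<Rightarrow> real" where
  "p_dec D f = \<E> D (\<lambda>p. of_bool (f (snd p) < f (fst p)))"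

context
  fixes D :: "(nat list \<times> nat list) pmf"
  assumes finD: "finite (set_pmf D)"
begin

lemma finite_search: "finite (set_pmf (search D b k))"
  by (induction k) (auto simp: finD)

lemma finite_trial: "finite (set_pmf (trial D k))"
  by (auto simp: trial_def finD finite_search)

lemma queries_in_search:
  assumes "set_pmf D \<subseteq> G \<times> G"
  shows "t \<in> set_pmf (search D b k) \<Longrightarrow> queries_in G t"
  using assms by (induction k arbitrary: t) (auto dest!: subsetD)

lemma queries_in_trial:
  assumes "set_pmf D \<subseteq> G \<times> G" "t \<in> set_pmf (trial D k)"
  shows "queries_in G t"
  using assms queries_in_search[OF assms(1)] by (auto simp: trial_def dest!: subsetD[OF assms(1)])

lemma run_search:
  assumes "\<And>x y. (x, y) \<in> set_pmf D \<Longrightarrow> f x \<noteq> f y \<Longrightarrow> (f x < f y) = b"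
  shows "t \<in> set_pmf (search D b k) \<Longrightarrow> run t f"
  using assms by (induction k arbitrary: t) auto

lemma run_trial:
  assumes "\<And>x y. (x, y) \<in> set_pmf D \<Longrightarrow> f x \<noteq> f y \<Longrightarrow> (f x < f y) = b" "t \<in> set_pmf (trial D k)"
  shows "run t f"
proof -
  obtain x y s s' where *: "(x, y) \<in> set_pmf D" "s \<in> set_pmf (search D True k)" "s' \<in> set_pmf (search D False k)"
    "t = Query x (\<lambda>u. Query y (\<lambda>v. if u = v then Output True else if u < v then s else s'))"
    using assms(2) by (auto simp: trial_def)
  show ?thesis
    using *(2,3) assms(1)[OF *(1)] run_search[of f b, OF assms(1)] by (cases b) (auto simp: *(4))
qed

lemma integrable_D: "integrable (measure_pmf D) (g :: _ \<Rightarrow> real)"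
  using finD by (auto intro: integrable_measure_pmf_finite)

lemma p_nonneg: "0 \<le> p_inc D f" "0 \<le> p_dec D f"
  by (auto simp: p_inc_def p_dec_def intro!: integral_nonneg_AE)

lemma p_eq: "\<E> D (\<lambda>p. of_bool (f (fst p) = f (snd p))) = 1 - (p_inc D f + p_dec D f)"
proof -
  have "\<E> D (\<lambda>p. of_bool (f (fst p) < f (snd p)) + of_bool (f (snd p) < f (fst p))
      + of_bool (f (fst p) = f (snd p))) = \<E> D (\<lambda>_. 1 :: real)"
    by (rule Bochner_Integration.integral_cong) auto
  then show ?thesis by (simp add: p_inc_def p_dec_def integrable_D case_prod_unfold)
qed

lemma p_le_1: "p_inc D f + p_dec D f \<le> 1"
proof -
  have "0 \<le> \<E> D (\<lambda>p. of_bool (f (fst p) = f (snd p)) :: real)" by simp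
  then show ?thesis by (simp add: p_eq)
qed

text \<open>With p the probability of a nonconstant pair, the expected cost obeys
  \<open>E (k + 1) = 2 + (1 - p) * E k\<close> and so stays at most 2 / p. The product form also
  covers p = 0.\<close>

lemma cost_search: "(p_inc D f + p_dec D f) * \<E> (search D b k) (\<lambda>t. cost t f) \<le> 2"
proof (induction k)
  case 0
  then show ?case by simp
next
  case (Suc k)
  let ?p = "p_inc D f + p_dec D f" and ?E = "\<E> (search D b k) (\<lambda>t. real (cost t f))"
  have I: "integrable (measure_pmf (search D b k)) g" for g :: "qtree \<Rightarrow> real"
    using finite_search by (auto intro: integrable_measure_pmf_finite)
  have "\<E> (search D b (Suc k)) (\<lambda>t. cost t f)
      = \<E> D (\<lambda>(x, y). \<E> (search D b k) (\<lambda>t. 2 + of_bool (f x = f y) * real (cost t f)))"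
    by (simp add: expectation_bind finD finite_search case_prod_unfold) 
      (intro Bochner_Integration.integral_cong refl, auto)
  also have "\<dots> = \<E> D (\<lambda>(x, y). 2 + of_bool (f x = f y) * ?E)"
    using I by simp
  also have "\<dots> = 2 + \<E> D (\<lambda>(x, y). of_bool (f x = f y)) * ?E"
    by (simp add: case_prod_unfold integrable_D)
  also have "\<dots> = 2 + (1 - ?p) * ?E" by (simp add: p_eq case_prod_unfold)
  finally have E: "\<E> (search D b (Suc k)) (\<lambda>t. cost t f) = 2 + (1 - ?p) * ?E" .
  have "?p * \<E> (search D b (Suc k)) (\<lambda>t. cost t f) = 2 * ?p + (1 - ?p) * (?p * ?E)"
    unfolding E by (simp add: algebra_simps)
  also have "\<dots> \<le> 2 * ?p + (1 - ?p) * 2"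
    using Suc p_le_1[of f] by (intro add_left_mono mult_left_mono) simp_all
  finally show ?case by simp
qed

text \<open>A nonconstant pair appears among \<open>k\<close> samples with probability
  \<open>1 - (1 - p) ^ k\<close>, and the first such pair has the opposite direction with
  probability \<open>p_dec / p\<close> or \<open>p_inc / p\<close>. Multiplying by p avoids the
  division.\<close>

lemma accept_search:
  "(p_inc D f + p_dec D f) * (1 - accept_prob (search D b k) f)
     = (1 - (1 - (p_inc D f + p_dec D f)) ^ k) * (if b then p_dec D f else p_inc D f)"
proof (induction k)
  case 0
  then show ?case by (simp add: accept_prob_eq)
next
  case (Suc k)
  let ?p = "p_inc D f + p_dec D f" and ?a = "accept_prob (search D b k) f" and ?m = "if b then p_dec D f else p_inc D f"
  have I: "integrable (measure_pmf (search D b k)) g" for g :: "qtree \<Rightarrow> real"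
    using finite_search by (auto intro: integrable_measure_pmf_finite)
  have "accept_prob (search D b (Suc k)) f
      = \<E> D (\<lambda>(x, y). \<E> (search D b k) (\<lambda>t. of_bool (if b then f x < f y else f y < f x) + of_bool (f x = f y) * of_bool (run t f)))"
    unfolding accept_prob_eq
    by (simp add: expectation_bind finD finite_search case_prod_unfold) 
      (intro Bochner_Integration.integral_cong refl, auto)
  also have "\<dots> = \<E> D (\<lambda>(x, y). of_bool (if b then f x < f y else f y < f x) + of_bool (f x = f y) * ?a)"
    using I by (simp add: accept_prob_eq)
  also have "\<dots> = (?p - ?m) + \<E> D (\<lambda>(x, y). of_bool (f x = f y)) * ?a"
    by (simp add: case_prod_unfold integrable_D p_inc_def p_dec_def)
  also have "\<dots> = ?p - ?m + (1 - ?p) * ?a" by (simp add: p_eq case_prod_unfold)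
  finally have E: "accept_prob (search D b (Suc k)) f = ?p - ?m + (1 - ?p) * ?a" .
  have "?p * (1 - accept_prob (search D b (Suc k)) f) = ?p * ?m + (1 - ?p) * (?p * (1 - ?a))"
    unfolding E by (simp add: algebra_simps)
  then show ?case unfolding Suc by (simp add: algebra_simps)
qed

text \<open>The first pair costs 2 queries; a search is entered with probability p and then costs at
  most 2 / p on average, which adds at most 2.\<close>

lemma cost_trial: "\<E> (trial D k) (\<lambda>t. cost t f) \<le> 4"
proof -
  let ?E = "\<lambda>b. \<E> (search D b k) (\<lambda>t. real (cost t f))"
  have I: "integrable (measure_pmf (search D b k)) g" for b and g :: "qtree \<Rightarrow> real"
    using finite_search by (auto intro: integrable_measure_pmf_finite)
  have "\<E> (trial D k) (\<lambda>t. cost t f)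
     = \<E> D (\<lambda>(x, y). \<E> (search D True k) (\<lambda>s. \<E> (search D False k) (\<lambda>t.
          2 + of_bool (f x < f y) * real (cost s f) + of_bool (f y < f x) * real (cost t f))))"
    unfolding trial_def
    by (simp add: expectation_bind finD finite_search case_prod_unfold)
      (intro Bochner_Integration.integral_cong refl, auto)
  also have "\<dots> = \<E> D (\<lambda>(x, y). 2 + of_bool (f x < f y) * ?E True + of_bool (f y < f x) * ?E False)"
    using I by simp
  also have "\<dots> = 2 + p_inc D f * ?E True + p_dec D f * ?E False"
    by (simp add: case_prod_unfold integrable_D p_inc_def p_dec_def)
  also have "\<dots> \<le> 4"
  proof (cases "p_inc D f + p_dec D f = 0")
    case True
    then show ?thesis using p_nonneg[of f] by (simp add: add_nonneg_eq_0_iff)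
  next
    case False
    then have p: "0 < p_inc D f + p_dec D f" using p_nonneg[of f] by simp
    have "(p_inc D f + p_dec D f) * (p_inc D f * ?E True + p_dec D f * ?E False)
        = p_inc D f * ((p_inc D f + p_dec D f) * ?E True) + p_dec D f * ((p_inc D f + p_dec D f) * ?E False)"
      by (simp add: algebra_simps)
    also have "\<dots> \<le> p_inc D f * 2 + p_dec D f * 2"
      by (intro add_mono mult_left_mono cost_search p_nonneg)
    also have "\<dots> = (p_inc D f + p_dec D f) * 2" by simp
    finally have "p_inc D f * ?E True + p_dec D f * ?E False \<le> 2" using p by (simp only: mult_le_cancel_left_pos)
    then show ?thesis by simp
  qed
  finally show ?thesis .
qed

text \<open>With unlimited resampling, opposite directions are seen with probability
  \<open>2 * p_inc * p_dec / p\<close>, which is at least the smaller of the two because the larger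
  is at least p / 2. With \<open>k * p\<close> at least 1 the search succeeds with probability at
  least 1/2.\<close>

lemma reject_trial:
  assumes k: "p_inc D f + p_dec D f > 0 \<Longrightarrow> 1 \<le> k * (p_inc D f + p_dec D f)"
  shows "min (p_inc D f) (p_dec D f) / 2 \<le> 1 - accept_prob (trial D k) f"
proof -
  let ?a = "\<lambda>b. accept_prob (search D b k) f" and ?p = "p_inc D f + p_dec D f"
  have I: "integrable (measure_pmf (search D b k)) g" for b and g :: "qtree \<Rightarrow> real"
    using finite_search by (auto intro: integrable_measure_pmf_finite)
  have "accept_prob (trial D k) f
     = \<E> D (\<lambda>(x, y). \<E> (search D True k) (\<lambda>s. \<E> (search D False k) (\<lambda>t.
          of_bool (f x = f y) + of_bool (f x < f y) * of_bool (run s f) + of_bool (f y < f x) * of_bool (run t f))))"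
    unfolding trial_def accept_prob_eq
    by (simp add: expectation_bind finD finite_search case_prod_unfold)
      (intro Bochner_Integration.integral_cong refl, auto)
  also have "\<dots> = \<E> D (\<lambda>(x, y). of_bool (f x = f y) + of_bool (f x < f y) * ?a True + of_bool (f y < f x) * ?a False)"
    using I by (simp add: accept_prob_eq)
  also have "\<dots> = 1 - ?p + p_inc D f * ?a True + p_dec D f * ?a False"
    by (simp add: p_eq[unfolded p_inc_def p_dec_def] case_prod_unfold integrable_D p_inc_def p_dec_def)
  finally have eq: "1 - accept_prob (trial D k) f = p_inc D f * (1 - ?a True) + p_dec D f * (1 - ?a False)"
    by (simp add: algebra_simps)
  show ?thesis
  proof (cases "?p = 0")
    case True
    then show ?thesis using p_nonneg[of f] eq by (simp add: add_nonneg_eq_0_iff)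
  next
    case False
    then have p: "0 < ?p" using p_nonneg[of f] by simp
      let ?c = "1 - (1 - ?p) ^ k"
    have "(1 - ?p) ^ k \<le> exp (- ?p) ^ k"
      using p_le_1[of f] exp_ge_add_one_self[of "- ?p"] by (intro power_mono) linarith+
    also have "\<dots> = exp (- (k * ?p))" by (simp only: mult_minus_right[symmetric] exp_of_nat_mult)
    also have "\<dots> \<le> exp (- 1)" using k[OF p] by simp
    also have "\<dots> \<le> 1 / 2" using exp_ge_add_one_self[of 1] by (simp add: exp_minus field_simps)
    finally have c: "1 / 2 \<le> ?c" by simp
    have "?p * (min (p_inc D f) (p_dec D f) / 2) \<le> max (p_inc D f) (p_dec D f) * min (p_inc D f) (p_dec D f)"
      using p_nonneg[of f] by (auto simp: min_def max_def algebra_simps intro: mult_mono)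
    also have "\<dots> = (1 / 2) * (2 * (p_inc D f * p_dec D f))" by (simp add: min_def max_def)
    also have "\<dots> \<le> ?c * (2 * (p_inc D f * p_dec D f))"
      using p_nonneg[of f] by (intro mult_right_mono c) simp
    also have "\<dots> = p_inc D f * (?p * (1 - ?a True)) + p_dec D f * (?p * (1 - ?a False))"
      unfolding accept_search by simp
    also have "\<dots> = ?p * (1 - accept_prob (trial D k) f)" unfolding eq by (simp add: algebra_simps)
    finally show ?thesis using p by simp
  qed
qed

end

subsection \<open>The tester\<close>

text \<open>A pair that would leave the grid becomes the constant pair \<open>(x, x)\<close>, so all
  event probabilities share the denominator \<open>A * card (hypergrid n d)\<close>.\<close>

definition axis_pairs :: "nat \<Rightarrow> nat \<Rightarrow> nat \<Rightarrow> nat \<Rightarrow> (nat list \<times> nat list) pmf" where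
  "axis_pairs n d A r = map_pmf (\<lambda>(a, x). (x, if x ! r + 2 ^ a \<le> n then x[r := x ! r + 2 ^ a] else x))
     (pmf_of_set ({..<A} \<times> hypergrid n d))"

lemma hypergrid_nonempty: "0 < n \<Longrightarrow> hypergrid n d \<noteq> {}"
proof -
  assume "0 < n"
  then have "replicate d 1 \<in> hypergrid n d" by (auto simp: hypergrid_def)
  then show ?thesis by blast
qed

lemma update_in_hypergrid:
  "x \<in> hypergrid n d \<Longrightarrow> x ! r + m \<le> n \<Longrightarrow> x[r := x ! r + m] \<in> hypergrid n d"
  by (cases "r < d") (auto simp: hypergrid_iff nth_list_update)

text \<open>A longer shift is a chain of unit steps, all of which stay in the grid.\<close>

lemma unate_axis:
  assumes up: "\<And>i x. i < d \<Longrightarrow> x \<in> hypergrid n d \<Longrightarrow> step x i \<in> hypergrid n d \<Longrightarrow>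
      if up i then f x \<le> f (step x i) else f x \<ge> (f (step x i) :: real)"
    and x: "x \<in> hypergrid n d" "r < d"
  shows "x ! r + m \<le> n \<Longrightarrow> if up r then f x \<le> f (x[r := x ! r + m]) else f x \<ge> f (x[r := x ! r + m])"
proof (induction m)
  case 0
  then show ?case by simp
next
  case (Suc m)
  have "r < length x" using x by (simp add: hypergrid_iff)
  then have eq: "step (x[r := x ! r + m]) r = x[r := x ! r + Suc m]" by (simp add: step_def)
  have "if up r then f (x[r := x ! r + m]) \<le> f (x[r := x ! r + Suc m])
      else f (x[r := x ! r + m]) \<ge> f (x[r := x ! r + Suc m])"
    unfolding eq[symmetric]
    by (rule up[OF x(2)]) (use update_in_hypergrid[OF x(1), of r] Suc.prems in \<open>simp_all add: eq del: add_Suc_right\<close>)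
  then show ?case using Suc by (auto split: if_splits)
qed

context
  fixes n d A :: nat
  assumes n: "0 < n" and A: "0 < A"
begin

lemma set_axis_pairs: "set_pmf (axis_pairs n d A r) =
    (\<lambda>(a, x). (x, if x ! r + 2 ^ a \<le> n then x[r := x ! r + 2 ^ a] else x)) ` ({..<A} \<times> hypergrid n d)"
  unfolding axis_pairs_def set_map_pmf
  using hypergrid_nonempty[OF n] A finite_hypergrid by (subst set_pmf_of_set) auto

lemma finite_axis_pairs: "finite (set_pmf (axis_pairs n d A r))"
  by (simp add: set_axis_pairs finite_hypergrid)

lemma axis_pairs_subset: "set_pmf (axis_pairs n d A r) \<subseteq> hypergrid n d \<times> hypergrid n d"
  using update_in_hypergrid by (auto simp: set_axis_pairs)

lemma axis_pairs_directed:
  assumes "unate n d f" "r < d"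
  obtains b where "\<And>x y. (x, y) \<in> set_pmf (axis_pairs n d A r) \<Longrightarrow> f x \<noteq> f y \<Longrightarrow> (f x < f y) = b"
proof -
  obtain up where up: "\<And>i x. i < d \<Longrightarrow> x \<in> hypergrid n d \<Longrightarrow> step x i \<in> hypergrid n d \<Longrightarrow>
      if up i then f x \<le> f (step x i) else f x \<ge> f (step x i)"
    using assms(1) unfolding unate_def by blast
  have "(f x < f y) = up r" if "(x, y) \<in> set_pmf (axis_pairs n d A r)" "f x \<noteq> f y" for x y
  proof -
    obtain a where a: "x \<in> hypergrid n d" "y = (if x ! r + 2 ^ a \<le> n then x[r := x ! r + 2 ^ a] else x)"
      using \<open>(x, y) \<in> _\<close> by (auto simp: set_axis_pairs)
    then have "x ! r + 2 ^ a \<le> n" "y = x[r := x ! r + 2 ^ a]" using \<open>f x \<noteq> f y\<close> by (auto split: if_splits)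
    then show ?thesis
      using unate_axis[of d n up f, OF up a(1) assms(2), of "2 ^ a"] \<open>f x \<noteq> f y\<close> by (auto split: if_splits)
  qed
  then show ?thesis using that by blast
qed

lemma expectation_axis_pairs:
  fixes h :: "nat list \<times> nat list \<Rightarrow> real"
  shows "\<E> (axis_pairs n d A r) h * (A * card (hypergrid n d))
    = (\<Sum>a<A. \<Sum>x\<in>hypergrid n d. h (x, if x ! r + 2 ^ a \<le> n then x[r := x ! r + 2 ^ a] else x))"
proof -
  have fin: "finite ({..<A} \<times> hypergrid n d)" and ne: "{..<A} \<times> hypergrid n d \<noteq> {}"
    using finite_hypergrid hypergrid_nonempty[OF n] A by auto
  have "card ({..<A} \<times> hypergrid n d) \<noteq> 0" using fin ne by (meson card_0_eq)
  then show ?thesis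
    unfolding axis_pairs_def integral_map_pmf integral_pmf_of_set[OF ne fin]
    by (simp add: sum.cartesian_product case_prod_unfold card_cartesian_product)
qed

lemma p_bad:
  "p_dec (axis_pairs n d A r) f * (A * card (hypergrid n d)) = (\<Sum>a<A. card (bad n d f True r (2 ^ a)))"
  "p_inc (axis_pairs n d A r) f * (A * card (hypergrid n d)) = (\<Sum>a<A. card (bad n d f False r (2 ^ a)))"
proof -
  have *: "real (card (bad n d f b r m)) = (\<Sum>x\<in>hypergrid n d. of_bool (x \<in> bad n d f b r m))" for b m
  proof -
    have "hypergrid n d \<inter> bad n d f b r m = bad n d f b r m" by (auto simp: bad_def)
    then show ?thesis using finite_hypergrid by (simp add: of_bool_def sum.If_cases Int_def)
  qed
  show "p_dec (axis_pairs n d A r) f * (A * card (hypergrid n d)) = (\<Sum>a<A. card (bad n d f True r (2 ^ a)))"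
    unfolding p_dec_def expectation_axis_pairs of_nat_sum *
    by (intro sum.cong refl) (auto simp: bad_def)
  show "p_inc (axis_pairs n d A r) f * (A * card (hypergrid n d)) = (\<Sum>a<A. card (bad n d f False r (2 ^ a)))"
    unfolding p_inc_def expectation_axis_pairs of_nat_sum *
    by (intro sum.cong refl) (auto simp: bad_def)
qed

text \<open>The probabilities are integer multiples of
  \<open>1 / (A * card (hypergrid n d))\<close>, so a positive one is at least that. This justifies
  the number of retries in \<open>mix\<close>.\<close>

lemma p_granular:
  assumes "p_inc (axis_pairs n d A r) f + p_dec (axis_pairs n d A r) f > 0"
  shows "1 \<le> real (A * card (hypergrid n d)) * (p_inc (axis_pairs n d A r) f + p_dec (axis_pairs n d A r) f)"
proof -
  let ?p = "p_inc (axis_pairs n d A r) f + p_dec (axis_pairs n d A r) f"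
  let ?N = "A * card (hypergrid n d)"
  have eq: "real ?N * ?p = real ((\<Sum>a<A. card (bad n d f True r (2 ^ a))) + (\<Sum>a<A. card (bad n d f False r (2 ^ a))))"
    using p_bad[of r f] by (simp only: of_nat_add of_nat_mult) (simp add: algebra_simps)
  have "?N > 0" using A hypergrid_nonempty[OF n] finite_hypergrid by (simp add: card_gt_0_iff)
  then have "0 < real ?N * ?p" using assms by simp
  then show ?thesis unfolding eq of_nat_0_less_iff by linarith
qed

section \<open>Random dimension and repeated trials\<close>

definition mix :: "qtree pmf" where
  "mix = bind_pmf (pmf_of_set {..<d}) (\<lambda>r. trial (axis_pairs n d A r) (A * card (hypergrid n d)))"

context
  assumes d: "0 < d"
begin

lemma set_mix: "set_pmf mix = (\<Union>r<d. set_pmf (trial (axis_pairs n d A r) (A * card (hypergrid n d))))"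
  using d by (auto simp: mix_def set_pmf_of_set lessThan_empty_iff)

lemma finite_mix: "finite (set_pmf mix)"
  unfolding set_mix using finite_trial[OF finite_axis_pairs] by auto

lemma expectation_mix: "\<E> mix h = (\<Sum>r<d. \<E> (trial (axis_pairs n d A r) (A * card (hypergrid n d))) h) / d"
  for h :: "qtree \<Rightarrow> real"
  unfolding mix_def using d
  by (subst expectation_bind)
    (auto simp: finite_trial[OF finite_axis_pairs] integral_pmf_of_set lessThan_empty_iff)

lemma cost_mix: "\<E> mix (\<lambda>t. cost t f) \<le> 4"
proof -
  have "\<E> mix (\<lambda>t. cost t f) \<le> (\<Sum>r<d. 4) / d"
    unfolding expectation_mix by (intro divide_right_mono sum_mono cost_trial finite_axis_pairs) simp
  then show ?thesis using d by simp
qed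

text \<open>With the direction of fewer violations taken in each dimension, the minima of
  \<open>p_inc\<close> and \<open>p_dec\<close> sum to at least \<open>\<epsilon> / (4 * A)\<close>.
  A trial rejects with at least half the minimum of its dimension, and averaging over
  \<open>d\<close> dimensions gives the bound.\<close>

lemma accept_mix:
  assumes far: "far_from_unate n d \<epsilon> f" and nA: "n \<le> 2 ^ A"
  shows "accept_prob mix f \<le> 1 - \<epsilon> / (8 * A * d)"
proof -
  let ?D = "axis_pairs n d A" and ?N = "card (hypergrid n d)"
  let ?m = "\<lambda>r. min (p_inc (?D r) f) (p_dec (?D r) f)"
  have N: "?N > 0" using hypergrid_nonempty[OF n] finite_hypergrid by (simp add: card_gt_0_iff)
  define up where "up r \<longleftrightarrow> p_dec (?D r) f \<le> p_inc (?D r) f" for r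
  have m: "?m r * (A * ?N) = (\<Sum>a<A. card (bad n d f (up r) r (2 ^ a)))" for r
    using p_bad[of r f] by (cases "up r") (auto simp: up_def min_def)
  have "\<epsilon> * ?N \<le> 4 * real (\<Sum>r<d. \<Sum>a<A. card (bad n d f (up r) r (2 ^ a)))"
    using far_from_unate_bound[OF far nA n, of up] by simp
  also have "\<dots> = 4 * (\<Sum>r<d. ?m r * (A * ?N))" unfolding m of_nat_sum by simp
  also have "\<dots> = (4 * A * (\<Sum>r<d. ?m r)) * ?N" by (simp add: sum_distrib_left sum_distrib_right mult_ac)
  finally have "\<epsilon> \<le> 4 * A * (\<Sum>r<d. ?m r)" using N by simp
  moreover have "(\<Sum>r<d. ?m r / 2) \<le> (\<Sum>r<d. 1 - accept_prob (trial (?D r) (A * ?N)) f)"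
    by (intro sum_mono reject_trial finite_axis_pairs p_granular)
  then have "(\<Sum>r<d. ?m r) / 2 \<le> d - d * accept_prob mix f"
    using d unfolding accept_prob_eq expectation_mix by (simp add: sum_subtractf flip: sum_divide_distrib)
  then have "4 * A * (\<Sum>r<d. ?m r) \<le> 4 * A * (2 * (d - d * accept_prob mix f))"
    by (intro mult_left_mono) simp_all
  ultimately have "\<epsilon> \<le> 4 * A * (2 * (d - d * accept_prob mix f))" by (rule order_trans)
  then show ?thesis using A d by (simp add: field_simps)
qed

lemma run_mix:
  assumes "unate n d f" "t \<in> set_pmf mix"
  shows "run t f"
proof -
  obtain r where r: "r < d" "t \<in> set_pmf (trial (axis_pairs n d A r) (A * card (hypergrid n d)))"
    using assms(2) by (auto simp: set_mix)
  then show ?thesis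
    using axis_pairs_directed[OF assms(1) r(1)] run_trial[OF finite_axis_pairs] by metis
qed

text \<open>A far function survives \<open>m\<close> trials with probability at most
  \<open>exp (- 3)\<close>, which is at most 1/8. The expected cost is at most \<open>4 * m\<close>,
  so the budget \<open>24 * m\<close> is exceeded with probability at most 1/6, and 1/8 + 1/6 <
  1/3.\<close>

lemma tester:
  assumes nA: "n \<le> 2 ^ A" and \<epsilon>: "0 < \<epsilon>" and m: "24 * A * d / \<epsilon> \<le> m"
  shows "one_sided_unateness_tester n d \<epsilon> (24 * m) (map_pmf (\<lambda>t. truncate t (24 * m)) (repeat m mix))"
  unfolding one_sided_unateness_tester_def
proof (intro conjI ballI allI impI)
  fix t assume "t \<in> set_pmf (map_pmf (\<lambda>t. truncate t (24 * m)) (repeat m mix))"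
  then obtain s where s: "s \<in> set_pmf (repeat m mix)" "t = truncate s (24 * m)" by auto
  have "queries_in (hypergrid n d) s"
    using s(1)
    by (rule repeat_invariant[rotated 3])
      (auto simp: set_mix queries_in_both intro: queries_in_trial[OF finite_axis_pairs axis_pairs_subset])
  then show "within_budget (hypergrid n d) (24 * m) t" using within_budget_truncate s(2) by simp
next
  fix f assume f: "unate n d f"
  have "run t f" if "t \<in> set_pmf (repeat m mix)" for t
    using that by (rule repeat_invariant[rotated 3]) (auto simp: run_both run_mix[OF f])
  then show "accept_prob (map_pmf (\<lambda>t. truncate t (24 * m)) (repeat m mix)) f = 1"
    unfolding accept_prob_def by (subst measure_pmf.prob_eq_1) (auto simp: AE_measure_pmf_iff run_truncate)
next
  fix f assume far: "far_from_unate n d \<epsilon> f"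
  let ?a = "accept_prob mix f" and ?\<eta> = "\<epsilon> / (8 * A * d)"
  have "?a ^ m \<le> exp (- ?\<eta>) ^ m"
    using accept_mix[OF far nA] exp_ge_add_one_self[of "- ?\<eta>"]
    by (intro power_mono) (simp_all add: accept_prob_def)
  also have "\<dots> = exp (- (m * ?\<eta>))" by (simp only: mult_minus_right[symmetric] exp_of_nat_mult)
  also have "\<dots> \<le> exp (- 3)" using m \<epsilon> A d by (simp add: field_simps)
  also have "\<dots> = exp (- 1) ^ 3" using exp_of_nat_mult[of 3 "- 1 :: real"] by simp
  also have "\<dots> \<le> (1 / 2) ^ 3"
    using exp_ge_add_one_self[of 1] by (intro power_mono) (simp_all add: exp_minus field_simps)
  finally have "?a ^ m \<le> 1 / 8" by (simp add: power3_eq_cube)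
  moreover have "\<E> (repeat m mix) (\<lambda>t. cost t f) \<le> (24 * m) / 6"
  proof -
    have "m * \<E> mix (\<lambda>t. cost t f) \<le> real m * 4" by (intro mult_left_mono cost_mix) simp
    then show ?thesis using cost_repeat[OF finite_mix, of m f] by simp
  qed
  then have "accept_prob (map_pmf (\<lambda>t. truncate t (24 * m)) (repeat m mix)) f \<le> ?a ^ m + 1 / 6"
    using accept_truncate[OF finite_repeat[OF finite_mix], of m f "24 * m"] accept_repeat[OF finite_mix, of m f]
    by simp
  ultimately show "2 / 3 \<le> 1 - accept_prob (map_pmf (\<lambda>t. truncate t (24 * m)) (repeat m mix)) f" by simp
qed

end

end

text \<open>Such a grid has no edges, so every function is unate and none is far from unate.\<close>

lemma trivial_tester:
  assumes "n \<le> 1 \<or> d = 0" "0 < \<epsilon>"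
  shows "one_sided_unateness_tester n d \<epsilon> 0 (return_pmf (Output True))"
proof -
  have "step x i \<notin> hypergrid n d" if "i < d" "x \<in> hypergrid n d" for x i
    using that assms(1) by (auto simp: step_def hypergrid_iff intro!: exI[of _ i])
  then have "unate n d f" for f by (auto simp: unate_def)
  then have "\<not> far_from_unate n d \<epsilon> f" for f
    using assms(2) by (auto simp: far_from_unate_def grid_dist_def intro!: exI[of _ f])
  then show ?thesis
    by (auto simp: one_sided_unateness_tester_def accept_prob_def intro: within_budget.intros)
qed

theorem theorem1:
  shows "\<exists>C::real. C > 0 \<and>
    (\<forall>n d :: nat. \<forall>\<epsilon>::real. 0 < \<epsilon> \<and> \<epsilon> < 1/2 \<longrightarrow>
      (\<exists>T q. one_sided_unateness_tester n d \<epsilon> q T \<and>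
         real q \<le> C * real d * log 2 (real (max d n)) / \<epsilon>))"
proof (intro exI[of _ 2304] conjI allI impI)
  fix n d :: nat and \<epsilon> :: real
  assume \<epsilon>: "0 < \<epsilon> \<and> \<epsilon> < 1 / 2"
  show "\<exists>T q. one_sided_unateness_tester n d \<epsilon> q T \<and> real q \<le> 2304 * real d * log 2 (real (max d n)) / \<epsilon>"
  proof (cases "n \<le> 1 \<or> d = 0")
    case True
    \<comment> \<open>For \<open>n = d = 0\<close> the logarithm of 0 takes its default value 0;
      otherwise the argument is at least 1.\<close>
    have "0 \<le> log 2 (real (max d n))" by (cases "max d n = 0") (auto simp: log_def)
    then have "real 0 \<le> 2304 * real d * log 2 (real (max d n)) / \<epsilon>" using \<epsilon> by simp
    then show ?thesis using trivial_tester[OF True] \<epsilon> by blast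
  next
    case False
    then have n: "2 \<le> n" and d: "1 \<le> d" by auto
    define L where "L = log 2 (real n)"
    define A where "A = nat \<lceil>L\<rceil>"
    have L: "1 \<le> L" using n by (simp add: L_def)
    have A: "0 < A" "real A \<le> 2 * L" "L \<le> real A"
      unfolding A_def using L by linarith+
    have "real n = 2 powr L" using n by (simp add: L_def)
    also have "\<dots> \<le> 2 powr real A" using A(3) by simp
    finally have nA: "n \<le> 2 ^ A" by (simp add: powr_realpow flip: of_nat_le_iff)
    define m where "m = nat \<lceil>24 * A * d / \<epsilon>\<rceil>"
    have x: "1 \<le> 24 * A * d / \<epsilon>"
    proof -
      have "1 \<le> real A * real d" using A(1) d by (simp flip: of_nat_mult)
      then show ?thesis using \<epsilon> by (simp add: field_simps)
    qed
    have m: "24 * A * d / \<epsilon> \<le> m" "m \<le> 24 * A * d / \<epsilon> + 1" unfolding m_def using x by linarith+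
    have "one_sided_unateness_tester n d \<epsilon> (24 * m) (map_pmf (\<lambda>t. truncate t (24 * m)) (repeat m (mix n d A)))"
      by (rule tester) (use n A d nA \<epsilon> m in auto)
    moreover have "real (24 * m) \<le> 2304 * real d * log 2 (real (max d n)) / \<epsilon>"
    proof -
      \<comment> \<open>Rounding up \<open>L\<close> and rounding up to \<open>m\<close> each cost a
        factor of at most 2, as both quantities are at least 1; the constant is 24 * 2 * 24 * 2 =
        2304.\<close>
      have "real (24 * m) \<le> 24 * (2 * (24 * A * d / \<epsilon>))" using m(2) x by simp
      also have "\<dots> = 1152 * (A * d) / \<epsilon>" by simp
      also have "\<dots> \<le> 1152 * ((2 * L) * d) / \<epsilon>"
        using mult_right_mono[OF A(2), of "real d"] \<epsilon> by (intro divide_right_mono) auto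
      also have "L \<le> log 2 (real (max d n))" unfolding L_def using n by simp
      then have "1152 * ((2 * L) * d) / \<epsilon> \<le> 2304 * real d * log 2 (real (max d n)) / \<epsilon>"
        using mult_left_mono[of L "log 2 (real (max d n))" "real d"] \<epsilon> by (intro divide_right_mono) (auto simp: mult.commute)
      finally show ?thesis .
    qed
    ultimately show ?thesis by blast
  qed
qed simp

end
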